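(* Let $O=1$ (a single output), with inputs and outputs disjoint and $G(\cdot;\kappa)$ strictly convex on the input-constraint surface $\{x\in\mathbb R^N: P^\top x=v\}$. Then the equilibrium propagation (EP) and coupled learning (CL) flows satisfy $$\dot\kappa_{\mathrm{CL}}=D(\kappa)\,\dot\kappa_{\mathrm{EP}},\qquad D(\kappa)=\bigl(Q^\top R(\kappa)\,Q\bigr)^{-1},$$ with $D(\kappa)$ a positive scalar: $R$ is positive semidefinite with $\ker R=\operatorname{range}(P)$, and $Q\notin\operatorname{range}(P)$ because inputs and outputs are disjoint, so $Q^\top R\,Q>0$. The two vector fields therefore differ pointwise by a positive continuous scalar, a time change maps one flow onto the other, and the two flows have identical orbits and identical $\omega$-limit sets. Any selection difference between EP and CL (a difference in which point of the solution set is reached from a common initialization) requires $O\ge 2$. This holds beyond linear circuits, for general separable energies $G(x;\kappa)=\sum_i g_i(\kappa_i)\,\widetilde G_i(x)$: single-output benchmarks cannot reveal an inductive-bias difference (a difference in which solution training selects) between EP and CL.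
   Context: Circuit. A circuit is a connected graph on $N$ nodes with $M$ trainable edges; edge $e$ carries a conductance $\kappa_e>0$ and an incidence vector $d_e\in\mathbb R^N$. The vector of node voltages $x\in\mathbb R^N$ minimizes the co-content $G(x;\kappa)$ subject to the voltage constraints. For a linear circuit $G(x;\kappa)=\tfrac12\langle x,L(\kappa)x\rangle$ with $L(\kappa)=\sum_e\kappa_e d_ed_e^\top$. More generally one considers separable energies $G(x;\kappa)=\sum_i g_i(\kappa_i)\,\widetilde G_i(x)$, where $\kappa_i$ are the trainable parameters. Inputs and outputs. Inputs are imposed as voltage constraints $P^\top x=v$ on a set of input nodes that includes ground; outputs are read at nodes disjoint from the input nodes through $Q^\top x$, with $Q\in\mathbb R^{N\times O}$, where $O$ is the number of outputs. The free state is $x_0=\arg\min\{G(x;\kappa):P^\top x=v\}$. For a target $w\in\mathbb R^O$ the error is $r=Q^\top x_0-w$. The solution set is $\mathcal S=\{\kappa: Q^\top x_0(\kappa)=w\}$. Resolvent. $R=R(\kappa)$ is the input-constrained resolvent: $y=Rf$ is the solution of $Hy+P\mu=f$, $P^\top y=0$ (with $\mu$ the multiplier of the input constraint), where $H=L(\kappa)$ for a linear circuit and, in general, $H$ is the Hessian of $G(\cdot;\kappa)$ at the free state $x_0$. Learning flows. EP nudges the free state by adding a force $\eta Qr$ to the energy; CL nudges it by imposing the constraint $Q^\top x_\eta=(1+\eta)Q^\top x_0-\eta w$. In the idealized continuous-time, zero-nudge limit ($\eta\to0$), both flows take the form $$\dot\kappa_i=\bigl\langle y,\ \partial_{\kappa_i}\nabla_xG(x_0;\kappa)\bigr\rangle,$$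 which for a linear circuit is $\dot\kappa_e=(d_e^\top y)(d_e^\top x_0)$, with $y=y_{\mathrm{EP}}=R\,Qr$ for EP and $y=y_{\mathrm{CL}}=R\,QDr$, $D=(Q^\top RQ)^{-1}$, for CL. Throughout, an edge whose conductance reaches zero is removed and stays removed.
   Formalization: For nonlinear separable energies, existence of the free state and of the resolvent R is assumed (strict convexity alone does not give them), the energies G̃_i are taken C², and each g_i differentiable on the reals, or for conductances on κ>0, continuous at 0 with g_i(0)=0. *)

theory Defs
  imports "HOL-Analysis.Analysis"
begin

section \<open>Energies\<close>

text \<open>An energy (co-content) \<open>G \<kappa> x\<close> takes the trainable parameters \<open>\<kappa> :: real^'m\<close> and the
  node voltages \<open>x :: real^'n\<close>.\<close>

definition grad :: "(real^'n \<Rightarrow> real) \<Rightarrow> real^'n \<Rightarrow> real^'n" where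
  "grad f x = (THE D. GDERIV f x :> D)"

definition hessian :: "(real^'n \<Rightarrow> real) \<Rightarrow> real^'n \<Rightarrow> real^'n^'n" where
  "hessian f x = jacobian (grad f) (at x)"

definition C2 :: "(real^'n \<Rightarrow> real) \<Rightarrow> bool" where
  "C2 f \<longleftrightarrow> (\<forall>x. f differentiable (at x)) \<and> (\<forall>x. grad f differentiable (at x))
     \<and> continuous_on UNIV (hessian f)"

definition strictly_convex_on :: "(real^'n) set \<Rightarrow> (real^'n \<Rightarrow> real) \<Rightarrow> bool" where
  "strictly_convex_on S f \<longleftrightarrow> convex S \<and>
     (\<forall>x\<in>S. \<forall>y\<in>S. \<forall>u. x \<noteq> y \<and> 0 < u \<and> u < 1 \<longrightarrow>
        f ((1 - u) *\<^sub>R x + u *\<^sub>R y) < (1 - u) * f x + u * f y)"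

definition separable_energy ::
    "('m::finite \<Rightarrow> real \<Rightarrow> real) \<Rightarrow> ('m \<Rightarrow> real^'n \<Rightarrow> real) \<Rightarrow> real^'m \<Rightarrow> real^'n \<Rightarrow> real" where
  "separable_energy g \<Phi> \<kappa> x = (\<Sum>i\<in>UNIV. g i (\<kappa> $ i) * \<Phi> i x)"

text \<open>The set \<open>C\<close> collects the parameters that are conductances: they range over
  \<open>[0, \<infinity>)\<close>, and the value \<open>0\<close> encodes a removed edge, which therefore must not contribute to
  the energy. The remaining parameters range over all reals and are never removed.\<close>

definition regular_separable ::
    "'m::finite set \<Rightarrow> ('m \<Rightarrow> real \<Rightarrow> real) \<Rightarrow> ('m \<Rightarrow> real^'n \<Rightarrow> real) \<Rightarrow> bool" where
  "regular_separable C g \<Phi> \<longleftrightarrow> (\<forall>i. C2 (\<Phi> i)) \<and>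
     (\<forall>i. if i \<in> C
          then g i 0 = 0 \<and> continuous_on {0..} (g i) \<and> (\<forall>c>0. g i differentiable (at c))
          else \<forall>c. g i differentiable (at c))"

section \<open>Linear circuits\<close>

text \<open>Edge \<open>e\<close> joins the nodes \<open>s e\<close> and \<open>t e\<close>; parallel edges are allowed.\<close>

definition connected_circuit :: "('m \<Rightarrow> 'n) \<Rightarrow> ('m \<Rightarrow> 'n) \<Rightarrow> bool" where
  "connected_circuit s t \<longleftrightarrow> (\<forall>e. s e \<noteq> t e) \<and>
     (\<forall>a b. (a, b) \<in> (range (\<lambda>e. (s e, t e)) \<union> range (\<lambda>e. (t e, s e)))\<^sup>*)"

definition incidence_vector :: "('m \<Rightarrow> 'n) \<Rightarrow> ('m \<Rightarrow> 'n) \<Rightarrow> 'm \<Rightarrow> real^'n" where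
  "incidence_vector s t e = axis (s e) 1 - axis (t e) 1"

definition laplacian :: "('m::finite \<Rightarrow> 'n) \<Rightarrow> ('m \<Rightarrow> 'n) \<Rightarrow> real^'m \<Rightarrow> real^'n^'n" where
  "laplacian s t \<kappa> =
     (\<Sum>e\<in>UNIV. (\<kappa> $ e) *\<^sub>R (\<chi> i j. incidence_vector s t e $ i * incidence_vector s t e $ j))"

definition linear_circuit_energy ::
    "('m::finite \<Rightarrow> 'n) \<Rightarrow> ('m \<Rightarrow> 'n) \<Rightarrow> real^'m \<Rightarrow> real^'n \<Rightarrow> real" where
  "linear_circuit_energy s t \<kappa> x = 1/2 * (x \<bullet> (laplacian s t \<kappa> *v x))"

section \<open>Inputs, outputs, free state\<close>

text \<open>The columns of \<open>P\<close> are the basis vectors of the input nodes \<open>inp j\<close>.\<close>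

definition input_matrix :: "('p \<Rightarrow> 'n) \<Rightarrow> real^'p^'n" where
  "input_matrix inp = (\<chi> i j. if i = inp j then 1 else 0)"

text \<open>The outputs \<open>Q\<^sup>T x\<close> are independent linear readouts of non-input nodes. This includes node
  voltages (columns of \<open>Q\<close> are distinct basis vectors) and voltage differences.\<close>

definition output_matrix :: "'n set \<Rightarrow> real^'o^'n \<Rightarrow> bool" where
  "output_matrix I Q \<longleftrightarrow> (\<forall>i\<in>I. \<forall>k. Q $ i $ k = 0) \<and> inj ((*v) Q)"

definition input_surface :: "real^'p^'n \<Rightarrow> real^'p \<Rightarrow> (real^'n) set" where
  "input_surface P v = {x. transpose P *v x = v}"

definition has_free_state ::
    "(real^'m \<Rightarrow> real^'n \<Rightarrow> real) \<Rightarrow> real^'p^'n \<Rightarrow> real^'p \<Rightarrow> real^'m \<Rightarrow> bool" where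
  "has_free_state G P v \<kappa> \<longleftrightarrow> (\<exists>x. is_arg_min (G \<kappa>) (\<lambda>x. x \<in> input_surface P v) x)"

definition free_state ::
    "(real^'m \<Rightarrow> real^'n \<Rightarrow> real) \<Rightarrow> real^'p^'n \<Rightarrow> real^'p \<Rightarrow> real^'m \<Rightarrow> real^'n" where
  "free_state G P v \<kappa> = arg_min_on (G \<kappa>) (input_surface P v)"

definition output_error ::
    "(real^'m \<Rightarrow> real^'n \<Rightarrow> real) \<Rightarrow> real^'p^'n \<Rightarrow> real^'o^'n \<Rightarrow> real^'p \<Rightarrow> real^'o \<Rightarrow> real^'m \<Rightarrow> real^'o" where
  "output_error G P Q v w \<kappa> = transpose Q *v free_state G P v \<kappa> - w"

section \<open>Resolvent\<close>

definition resolvent_solution ::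
    "real^'n^'n \<Rightarrow> real^'p^'n \<Rightarrow> real^'n \<Rightarrow> real^'n \<Rightarrow> bool" where
  "resolvent_solution H P f y \<longleftrightarrow> (\<exists>\<mu>. H *v y + P *v \<mu> = f) \<and> transpose P *v y = 0"

definition free_hessian ::
    "(real^'m \<Rightarrow> real^'n \<Rightarrow> real) \<Rightarrow> real^'p^'n \<Rightarrow> real^'p \<Rightarrow> real^'m \<Rightarrow> real^'n^'n" where
  "free_hessian G P v \<kappa> = hessian (G \<kappa>) (free_state G P v \<kappa>)"

text \<open>For nonlinear energies this does not follow from strict convexity: a quartic minimum has a
  singular Hessian.\<close>

definition has_resolvent ::
    "(real^'m \<Rightarrow> real^'n \<Rightarrow> real) \<Rightarrow> real^'p^'n \<Rightarrow> real^'p \<Rightarrow> real^'m \<Rightarrow> bool" where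
  "has_resolvent G P v \<kappa> \<longleftrightarrow> (\<forall>f. \<exists>!y. resolvent_solution (free_hessian G P v \<kappa>) P f y)"

definition resolvent ::
    "(real^'m \<Rightarrow> real^'n \<Rightarrow> real) \<Rightarrow> real^'p^'n \<Rightarrow> real^'p \<Rightarrow> real^'m \<Rightarrow> real^'n^'n" where
  "resolvent G P v \<kappa> = matrix (\<lambda>f. THE y. resolvent_solution (free_hessian G P v \<kappa>) P f y)"

definition output_response ::
    "(real^'m \<Rightarrow> real^'n \<Rightarrow> real) \<Rightarrow> real^'p^'n \<Rightarrow> real^'o^'n \<Rightarrow> real^'p \<Rightarrow> real^'m \<Rightarrow> real^'o^'o" where
  "output_response G P Q v \<kappa> = transpose Q ** resolvent G P v \<kappa> ** Q"

definition clamp_matrix ::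
    "(real^'m \<Rightarrow> real^'n \<Rightarrow> real) \<Rightarrow> real^'p^'n \<Rightarrow> real^'o^'n \<Rightarrow> real^'p \<Rightarrow> real^'m \<Rightarrow> real^'o^'o" where
  "clamp_matrix G P Q v \<kappa> = matrix_inv (output_response G P Q v \<kappa>)"

section \<open>Learning flows\<close>

definition learning_velocity ::
    "(real^'m \<Rightarrow> real^'n \<Rightarrow> real) \<Rightarrow> real^'n \<Rightarrow> real^'n \<Rightarrow> real^'m \<Rightarrow> real^'m" where
  "learning_velocity G x y \<kappa> =
     (\<chi> i. y \<bullet> vector_derivative (\<lambda>c. grad (G (\<chi> j. if j = i then c else \<kappa> $ j)) x) (at (\<kappa> $ i)))"

definition EP_velocity ::
    "(real^'m \<Rightarrow> real^'n \<Rightarrow> real) \<Rightarrow> real^'p^'n \<Rightarrow> real^'o^'n \<Rightarrow> real^'p \<Rightarrow> real^'o \<Rightarrow> real^'m \<Rightarrow> real^'m" where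
  "EP_velocity G P Q v w \<kappa> = learning_velocity G (free_state G P v \<kappa>)
     (resolvent G P v \<kappa> *v (Q *v output_error G P Q v w \<kappa>)) \<kappa>"

definition CL_velocity ::
    "(real^'m \<Rightarrow> real^'n \<Rightarrow> real) \<Rightarrow> real^'p^'n \<Rightarrow> real^'o^'n \<Rightarrow> real^'p \<Rightarrow> real^'o \<Rightarrow> real^'m \<Rightarrow> real^'m" where
  "CL_velocity G P Q v w \<kappa> = learning_velocity G (free_state G P v \<kappa>)
     (resolvent G P v \<kappa> *v (Q *v (clamp_matrix G P Q v \<kappa> *v output_error G P Q v w \<kappa>))) \<kappa>"

definition lifespan :: "ereal \<Rightarrow> real set" where
  "lifespan T = {t. 0 \<le> t \<and> ereal t < T}"

text \<open>A trajectory in \<open>K\<close> of the field \<open>F\<close>: every parameter follows \<open>F\<close>, except that a conductance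
  (index in \<open>C\<close>) that is zero stays zero from then on, whatever \<open>F\<close> is.\<close>

definition trajectory ::
    "'m::finite set \<Rightarrow> (real^'m) set \<Rightarrow> (real^'m \<Rightarrow> real^'m) \<Rightarrow> (real \<Rightarrow> real^'m) \<Rightarrow> ereal \<Rightarrow> bool" where
  "trajectory C K F \<gamma> T \<longleftrightarrow> 0 < T \<and> continuous_on (lifespan T) \<gamma> \<and>
     (\<forall>t\<in>lifespan T. \<gamma> t \<in> K \<and>
        (\<forall>i. if i \<in> C \<and> \<gamma> t $ i = 0
             then \<forall>s\<in>lifespan T. t \<le> s \<longrightarrow> \<gamma> s $ i = 0
             else ((\<lambda>s. \<gamma> s $ i) has_real_derivative F (\<gamma> t) $ i) (at t within lifespan T)))"

definition maximal_trajectory ::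
    "'m::finite set \<Rightarrow> (real^'m) set \<Rightarrow> (real^'m \<Rightarrow> real^'m) \<Rightarrow> (real \<Rightarrow> real^'m) \<Rightarrow> ereal \<Rightarrow> bool" where
  "maximal_trajectory C K F \<gamma> T \<longleftrightarrow> trajectory C K F \<gamma> T \<and>
     \<not> (\<exists>\<gamma>' T'. T < T' \<and> trajectory C K F \<gamma>' T' \<and> (\<forall>t\<in>lifespan T. \<gamma>' t = \<gamma> t))"

text \<open>\<open>\<omega>\<close>-limits are taken at the end of the maximal interval of existence, finite or not: a time
  change need not preserve finiteness of the lifespan.\<close>

definition omega_limit_set :: "(real \<Rightarrow> real^'m) \<Rightarrow> ereal \<Rightarrow> (real^'m) set" where
  "omega_limit_set \<gamma> T = {p. \<exists>u. (\<forall>n. u n \<in> lifespan T) \<and> (\<lambda>n. ereal (u n)) \<longlonglongrightarrow> T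
     \<and> (\<lambda>n. \<gamma> (u n)) \<longlonglongrightarrow> p}"

definition time_end :: "ereal \<Rightarrow> real filter" where
  "time_end T = (if T = \<infinity> then at_top else at_left (real_of_ereal T))"

text \<open>Since the velocities need not be Lipschitz, several maximal trajectories may start at
  \<open>\<kappa>\<^sub>0\<close>; the following sets range over all of them.\<close>

definition orbits ::
    "'m::finite set \<Rightarrow> (real^'m) set \<Rightarrow> (real^'m \<Rightarrow> real^'m) \<Rightarrow> real^'m \<Rightarrow> (real^'m) set set" where
  "orbits C K F \<kappa>\<^sub>0 = {\<gamma> ` lifespan T | \<gamma> T. maximal_trajectory C K F \<gamma> T \<and> \<gamma> 0 = \<kappa>\<^sub>0}"

definition omega_limit_sets ::
    "'m::finite set \<Rightarrow> (real^'m) set \<Rightarrow> (real^'m \<Rightarrow> real^'m) \<Rightarrow> real^'m \<Rightarrow> (real^'m) set set" where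
  "omega_limit_sets C K F \<kappa>\<^sub>0 =
     {omega_limit_set \<gamma> T | \<gamma> T. maximal_trajectory C K F \<gamma> T \<and> \<gamma> 0 = \<kappa>\<^sub>0}"

text \<open>\<open>\<gamma>'\<close> is \<open>\<gamma>\<close> run at \<open>\<delta>\<close> times the speed.\<close>

definition time_changed ::
    "(real^'m \<Rightarrow> real) \<Rightarrow> (real \<Rightarrow> real^'m) \<Rightarrow> ereal \<Rightarrow> (real \<Rightarrow> real^'m) \<Rightarrow> ereal \<Rightarrow> bool" where
  "time_changed \<delta> \<gamma> T \<gamma>' T' \<longleftrightarrow>
     (\<exists>\<tau>. bij_betw \<tau> (lifespan T) (lifespan T') \<and> strict_mono_on (lifespan T) \<tau> \<and>
        (\<forall>t\<in>lifespan T.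
           (\<tau> has_real_derivative 1 / \<delta> (\<gamma> t)) (at t within lifespan T) \<and> \<gamma>' (\<tau> t) = \<gamma> t))"

section \<open>Selection\<close>

definition solution_set ::
    "(real^'m) set \<Rightarrow> (real^'m \<Rightarrow> real^'n \<Rightarrow> real) \<Rightarrow> real^'p^'n \<Rightarrow> real^'o^'n \<Rightarrow> real^'p \<Rightarrow> real^'o
      \<Rightarrow> (real^'m) set" where
  "solution_set K G P Q v w = {\<kappa>\<in>K. transpose Q *v free_state G P v \<kappa> = w}"

definition selected ::
    "'m::finite set \<Rightarrow> (real^'m) set \<Rightarrow> (real^'m \<Rightarrow> real^'m) \<Rightarrow> (real^'m) set \<Rightarrow> real^'m
      \<Rightarrow> (real^'m) set" where
  "selected C K F S \<kappa>\<^sub>0 =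
     {p\<in>S. \<exists>\<gamma> T. maximal_trajectory C K F \<gamma> T \<and> \<gamma> 0 = \<kappa>\<^sub>0 \<and> (\<gamma> \<longlongrightarrow> p) (time_end T)}"

definition selection_difference ::
    "'m::finite set \<Rightarrow> (real^'m) set \<Rightarrow> (real^'m \<Rightarrow> real^'n \<Rightarrow> real) \<Rightarrow> real^'p^'n \<Rightarrow> real^'o^'n
      \<Rightarrow> real^'p \<Rightarrow> real^'o \<Rightarrow> bool" where
  "selection_difference C K G P Q v w \<longleftrightarrow>
     (\<exists>\<kappa>\<^sub>0\<in>K. selected C K (EP_velocity G P Q v w) (solution_set K G P Q v w) \<kappa>\<^sub>0
            \<noteq> selected C K (CL_velocity G P Q v w) (solution_set K G P Q v w) \<kappa>\<^sub>0)"

end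

theory Submission
  imports Defs
begin

text \<open>For a single output, the clamping matrix \<open>D\<close> is a scalar, and the velocity is linear in the adjoint
  state, so \<open>F_CL = D F_EP\<close>. Since \<open>R\<close> is symmetric and positive semidefinite with kernel \<open>range P\<close>,
  \<open>D\<close> is positive. It is continuous because the free state is (it is the unique minimizer of a jointly
  continuous strictly convex energy) and because Cramer's rule expresses \<open>R\<close> through the Hessian at the
  free state. The clock \<open>\<tau>(t) = \<integral>\<^sub>0\<^sup>t 1 / D(\<gamma>(s)) ds\<close> then turns EP trajectories into CL trajectories; the
  clock for \<open>1 / D\<close> turns them back, and the two together carry over maximality. A linear circuit is the
  separable energy with \<open>g\<^sub>e(c) = c\<close> and features \<open>(d\<^sub>e\<^sup>T x)\<^sup>2 / 2\<close>.\<close>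

section \<open>Time changes of trajectories\<close>

text \<open>Nothing here makes trajectories unique, so the flows cannot be compared through a
  solution map: each trajectory is transported by its own clock, and statements about sets of
  trajectories follow by inclusion in both directions. A clock may turn an infinite lifespan into a
  finite one or conversely; for this reason ends of lifespans and limits there are expressed through
  the order of the lifespan alone. Sticking at zero survives because clocks are increasing. On the
  static side, strict convexity does not make the Hessian positive definite. Minimality of the free
  state yields semidefiniteness on the kernel of \<open>transpose P\<close>, and unique solvability
  of the constrained system supplies the strictness. Symmetry of the Hessian is not built into
  \<open>C2\<close> and comes from second differences. For linear circuits the free state and the
  resolvent exist because the strictly convex energy is quadratic; for other energies their
  existence is assumed.\<close>

lemma lifespan_downward:
  "t \<in> lifespan T \<Longrightarrow> 0 \<le> s \<Longrightarrow> s \<le> t \<Longrightarrow> s \<in> lifespan T"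
  unfolding lifespan_def by (auto intro: le_less_trans[of "ereal s" "ereal t"])

lemma zero_in_lifespan: "0 < T \<Longrightarrow> 0 \<in> lifespan T"
  by (simp add: lifespan_def zero_ereal_def)

lemma lifespan_nonneg: "t \<in> lifespan T \<Longrightarrow> 0 \<le> t"
  by (simp add: lifespan_def)

lemma Icc_subset_lifespan: "t \<in> lifespan T \<Longrightarrow> {0..t} \<subseteq> lifespan T"
  by (auto intro: lifespan_downward)

lemma convex_lifespan: "convex (lifespan T)"
  unfolding is_interval_convex_1[symmetric] is_interval_1
  by (meson lifespan_downward lifespan_nonneg order_trans)

text \<open>A lifespan is open at its end, so it has no last time. This lets every local question be
  moved to a compact interval.\<close>

lemma lifespan_beyond:
  assumes "t \<in> lifespan T"
  obtains b where "t < b" "b \<in> lifespan T"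
proof -
  have "ereal t < T" "0 \<le> t" using assms by (auto simp: lifespan_def)
  then obtain b where "ereal t < ereal b" "ereal b < T" using ereal_dense2 by blast
  then show thesis using \<open>0 \<le> t\<close> by (intro that[of b]) (auto simp: lifespan_def)
qed

text \<open>Differentiability and continuity are local, so a compact interval may replace the
  lifespan, including at the left endpoint 0, where derivatives are one-sided.\<close>

lemma at_within_lifespan:
  assumes "t < b" "b \<in> lifespan T"
  shows "at t within lifespan T = at t within {0..b}"
  by (rule at_within_nhd[where S = "{..<b}"])
    (use assms in \<open>auto intro: lifespan_downward dest: lifespan_nonneg\<close>)

text \<open>One description covers both finite and infinite ends and uses only points of the
  lifespan and their order, which is what an order isomorphism preserves.\<close>

lemma eventually_time_end:
  assumes "0 < T"
  shows "eventually p (time_end T) \<longleftrightarrow> (\<exists>a\<in>lifespan T. \<forall>t\<in>lifespan T. a < t \<longrightarrow> p t)"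
proof (cases T)
  case PInf
  have "(\<exists>N. \<forall>n>N. p n) \<longleftrightarrow> (\<exists>a\<ge>0. \<forall>t\<ge>0. a < t \<longrightarrow> p t)" (is "?L \<longleftrightarrow> ?R")
  proof
    assume ?L
    then obtain N where "\<forall>n>N. p n" ..
    then show ?R by (intro exI[of _ "max N 0"]) auto
  next
    assume ?R
    then obtain a where "a \<ge> 0" "\<forall>t\<ge>0. a < t \<longrightarrow> p t" by blast
    then show ?L by (intro exI[of _ a]) auto
  qed
  then show ?thesis using PInf
    by (auto simp: time_end_def eventually_at_top_dense lifespan_def Bex_def)
next
  case (real r)
  then have r: "0 < r" using assms by (simp add: zero_ereal_def)
  have "(\<exists>b<r. \<forall>y>b. y < r \<longrightarrow> p y) \<longleftrightarrow> (\<exists>a. 0 \<le> a \<and> a < r \<and> (\<forall>t. 0 \<le> t \<and> t < r \<longrightarrow> a < t \<longrightarrow> p t))"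
    (is "?L \<longleftrightarrow> ?R")
  proof
    assume ?L
    then obtain b where "b < r" "\<forall>y>b. y < r \<longrightarrow> p y" by blast
    then show ?R using r by (intro exI[of _ "max b 0"]) auto
  next
    assume ?R
    then obtain a where "0 \<le> a" "a < r" "\<forall>t. 0 \<le> t \<and> t < r \<longrightarrow> a < t \<longrightarrow> p t" by blast
    then show ?L by (intro exI[of _ a]) auto
  qed
  then show ?thesis using real r
    by (auto simp: time_end_def eventually_at_left[OF r] lifespan_def Bex_def)
qed (use assms in auto)

text \<open>All \<open>u n\<close> stay below \<open>T\<close>, so only lower bounds matter. A bound
  below \<open>T\<close> is either negative, hence below every time, or a finite point of the
  lifespan.\<close>

lemma tendsto_lifespan_end_iff:
  assumes "0 < T" "\<And>n. u n \<in> lifespan T"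
  shows "(\<lambda>n. ereal (u n)) \<longlonglongrightarrow> T \<longleftrightarrow> (\<forall>a\<in>lifespan T. \<forall>\<^sub>F n in sequentially. a < u n)"
proof
  assume L: "(\<lambda>n. ereal (u n)) \<longlonglongrightarrow> T"
  show "\<forall>a\<in>lifespan T. \<forall>\<^sub>F n in sequentially. a < u n"
  proof
    fix a assume "a \<in> lifespan T"
    then have "ereal a < T" by (simp add: lifespan_def)
    from order_tendstoD(1)[OF L this] show "\<forall>\<^sub>F n in sequentially. a < u n" by simp
  qed
next
  assume R: "\<forall>a\<in>lifespan T. \<forall>\<^sub>F n in sequentially. a < u n"
  have u: "0 \<le> u n" "ereal (u n) < T" for n using assms(2)[of n] by (auto simp: lifespan_def)
  show "(\<lambda>n. ereal (u n)) \<longlonglongrightarrow> T"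
  proof (rule order_tendstoI)
    fix a assume "a < T"
    show "\<forall>\<^sub>F n in sequentially. a < ereal (u n)"
    proof (cases "a < 0")
      case True
      then have "a < ereal (u n)" for n
        using u(1)[of n] by (metis ereal_less_eq(5) less_le_trans)
      then show ?thesis by simp
    next
      case False
      with \<open>a < T\<close> obtain r where "a = ereal r" by (cases a) auto
      with R False \<open>a < T\<close> show ?thesis by (auto simp: lifespan_def zero_ereal_def)
    qed
  next
    fix a assume "T < a"
    have "ereal (u n) < a" for n using u(2)[of n] \<open>T < a\<close> by (rule less_trans)
    then show "\<forall>\<^sub>F n in sequentially. ereal (u n) < a" by simp
  qed
qed

text \<open>The part of \<open>time_changed\<close> that concerns the clock as an order isomorphism,
  without its derivative. It suffices for everything about ends and limits.\<close>

definition lifespan_iso :: "(real \<Rightarrow> real) \<Rightarrow> ereal \<Rightarrow> ereal \<Rightarrow> bool" where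
  "lifespan_iso \<tau> T T' \<longleftrightarrow>
     bij_betw \<tau> (lifespan T) (lifespan T') \<and> strict_mono_on (lifespan T) \<tau>"

lemma time_changed_iso:
  "time_changed \<delta> \<gamma> T \<gamma>' T' \<longleftrightarrow> (\<exists>\<tau>. lifespan_iso \<tau> T T' \<and>
     (\<forall>t\<in>lifespan T.
        (\<tau> has_real_derivative 1 / \<delta> (\<gamma> t)) (at t within lifespan T) \<and> \<gamma>' (\<tau> t) = \<gamma> t))"
  by (auto simp: time_changed_def lifespan_iso_def)

context
  fixes \<tau> T T'
  assumes iso: "lifespan_iso \<tau> T T'"
begin

lemma lifespan_iso_image: "\<tau> ` lifespan T = lifespan T'"
  using iso by (simp add: lifespan_iso_def bij_betw_def)

lemma lifespan_iso_mem: "t \<in> lifespan T \<Longrightarrow> \<tau> t \<in> lifespan T'"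
  using lifespan_iso_image by blast

lemma lifespan_iso_less:
  "s \<in> lifespan T \<Longrightarrow> t \<in> lifespan T \<Longrightarrow> \<tau> s < \<tau> t \<longleftrightarrow> s < t"
  using iso strict_mono_on_less by (fastforce simp: lifespan_iso_def)

lemma lifespan_iso_le:
  "s \<in> lifespan T \<Longrightarrow> t \<in> lifespan T \<Longrightarrow> \<tau> s \<le> \<tau> t \<longleftrightarrow> s \<le> t"
  using iso strict_mono_on_less_eq by (fastforce simp: lifespan_iso_def)

lemma lifespan_iso_obtain:
  assumes "s \<in> lifespan T'"
  obtains t where "t \<in> lifespan T" "s = \<tau> t"
  using assms lifespan_iso_image by blast

lemma lifespan_iso_inv_into: "lifespan_iso (inv_into (lifespan T) \<tau>) T' T"
proof -
  have b: "bij_betw \<tau> (lifespan T) (lifespan T')" using iso by (simp add: lifespan_iso_def)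
  have i: "inj_on \<tau> (lifespan T)" using b by (simp add: bij_betw_def)
  show ?thesis unfolding lifespan_iso_def
  proof (intro conjI strict_mono_onI)
    show "bij_betw (inv_into (lifespan T) \<tau>) (lifespan T') (lifespan T)"
      by (rule bij_betw_inv_into[OF b])
    fix r s assume "r \<in> lifespan T'" "s \<in> lifespan T'" "r < s"
    then show "inv_into (lifespan T) \<tau> r < inv_into (lifespan T) \<tau> s"
      by (auto elim!: lifespan_iso_obtain simp: inv_into_f_f[OF i] lifespan_iso_less)
  qed
qed

lemma lifespan_iso_inv_into_f: "t \<in> lifespan T \<Longrightarrow> inv_into (lifespan T) \<tau> (\<tau> t) = t"
  using iso by (simp add: lifespan_iso_def bij_betw_def)

lemma lifespan_iso_pos: "0 < T \<Longrightarrow> 0 < T'"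
  using lifespan_iso_mem[of 0] zero_in_lifespan[of T]
  by (auto simp: lifespan_def zero_ereal_def intro: le_less_trans[of "ereal 0" "ereal (\<tau> 0)"])

lemma lifespan_iso_zero: "0 < T \<Longrightarrow> \<tau> 0 = 0"
proof -
  assume T: "0 < T"
  then have "0 \<in> lifespan T'" by (intro zero_in_lifespan lifespan_iso_pos)
  then obtain t where "t \<in> lifespan T" "0 = \<tau> t" by (rule lifespan_iso_obtain)
  then have "\<tau> 0 \<le> 0" using lifespan_iso_le[of 0 t] zero_in_lifespan[OF T] lifespan_nonneg by auto
  moreover have "0 \<le> \<tau> 0" using lifespan_iso_mem zero_in_lifespan[OF T] lifespan_nonneg by blast
  ultimately show ?thesis by simp
qed

lemma lifespan_iso_tendsto_end:
  assumes "0 < T" "\<And>n. u n \<in> lifespan T" "(\<lambda>n. ereal (u n)) \<longlonglongrightarrow> T"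
  shows "(\<lambda>n. ereal (\<tau> (u n))) \<longlonglongrightarrow> T'"
proof -
  have ev: "\<forall>a\<in>lifespan T. \<forall>\<^sub>F n in sequentially. a < u n"
    using tendsto_lifespan_end_iff[where u = u] assms by auto
  have "\<forall>\<^sub>F n in sequentially. b < \<tau> (u n)" if b: "b \<in> lifespan T'" for b
    using b
  proof (rule lifespan_iso_obtain)
    fix a assume a: "a \<in> lifespan T" "b = \<tau> a"
    with ev have "\<forall>\<^sub>F n in sequentially. a < u n" by blast
    then show ?thesis by eventually_elim (use assms(2) a lifespan_iso_less in auto)
  qed
  then show ?thesis
    using tendsto_lifespan_end_iff[OF lifespan_iso_pos[OF assms(1)], of "\<lambda>n. \<tau> (u n)"]
      lifespan_iso_mem assms(2) by auto
qed

lemma lifespan_iso_filterlim: "0 < T \<Longrightarrow> filterlim \<tau> (time_end T') (time_end T)"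
  unfolding filterlim_iff eventually_time_end[OF lifespan_iso_pos]
  by (auto simp: eventually_time_end elim!: lifespan_iso_obtain)
    (metis lifespan_iso_less lifespan_iso_mem)

text \<open>The inverse of a continuous injection on a compact set is continuous. Compactness is
  gained by choosing \<open>b\<close> beyond \<open>s\<close>: monotonicity makes the clock map
  \<open>{0..c}\<close> exactly onto \<open>{0..b}\<close>, and near \<open>s\<close> the lifespan
  looks like \<open>{0..b}\<close>.\<close>

lemma lifespan_iso_inverse_continuous:
  assumes "continuous_on (lifespan T) \<tau>"
  shows "continuous_on (lifespan T') (inv_into (lifespan T) \<tau>)"
  unfolding continuous_on_eq_continuous_within
proof
  fix s assume s: "s \<in> lifespan T'"
  obtain b where b: "s < b" "b \<in> lifespan T'" using lifespan_beyond[OF s] .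
  from b(2) obtain c where c: "c \<in> lifespan T" "b = \<tau> c" by (rule lifespan_iso_obtain)
  have "\<tau> ` {0..c} = {0..b}"
  proof (intro equalityI subsetI)
    fix r assume "r \<in> \<tau> ` {0..c}"
    then obtain t where t: "r = \<tau> t" "0 \<le> t" "t \<le> c" by auto
    with c have "t \<in> lifespan T" by (auto intro: lifespan_downward)
    with t c lifespan_iso_le lifespan_nonneg[OF lifespan_iso_mem] show "r \<in> {0..b}" by auto
  next
    fix r assume r: "r \<in> {0..b}"
    then have "r \<in> lifespan T'" using b by (auto intro: lifespan_downward)
    then obtain t where "t \<in> lifespan T" "r = \<tau> t" by (rule lifespan_iso_obtain)
    with r c lifespan_iso_le lifespan_nonneg show "r \<in> \<tau> ` {0..c}" by auto
  qed
  moreover have "continuous_on (\<tau> ` {0..c}) (inv_into (lifespan T) \<tau>)"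
    using c assms Icc_subset_lifespan
    by (intro continuous_on_inv) (auto intro: continuous_on_subset lifespan_iso_inv_into_f)
  ultimately have "continuous (at s within {0..b}) (inv_into (lifespan T) \<tau>)"
    using b s lifespan_nonneg by (auto simp: continuous_on_eq_continuous_within)
  then show "continuous (at s within lifespan T') (inv_into (lifespan T) \<tau>)"
    by (simp add: at_within_lifespan[OF b])
qed

end

section \<open>Inversion and existence of time changes, and transport of trajectories\<close>

lemma time_changed_image: "time_changed \<delta> \<gamma> T \<gamma>' T' \<Longrightarrow> \<gamma>' ` lifespan T' = \<gamma> ` lifespan T"
  by (auto simp: time_changed_iso image_image dest!: lifespan_iso_image[symmetric])

lemma time_changed_initial: "time_changed \<delta> \<gamma> T \<gamma>' T' \<Longrightarrow> 0 < T \<Longrightarrow> \<gamma>' 0 = \<gamma> 0"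
  by (metis time_changed_iso lifespan_iso_zero zero_in_lifespan)

lemma time_changed_pos: "time_changed \<delta> \<gamma> T \<gamma>' T' \<Longrightarrow> 0 < T \<Longrightarrow> 0 < T'"
  by (auto simp: time_changed_iso dest: lifespan_iso_pos)

text \<open>The inverse clock has the reciprocal derivative; positivity of \<delta> along the
  trajectory makes the derivative of the clock invertible, and continuity of the inverse clock was
  secured above.\<close>

lemma time_changed_sym:
  assumes tc: "time_changed \<delta> \<gamma> T \<gamma>' T'" and pos: "\<And>t. t \<in> lifespan T \<Longrightarrow> 0 < \<delta> (\<gamma> t)"
  shows "time_changed (\<lambda>\<kappa>. 1 / \<delta> \<kappa>) \<gamma>' T' \<gamma> T"
proof -
  obtain \<tau> where iso: "lifespan_iso \<tau> T T'"
    and der: "\<And>t. t \<in> lifespan T \<Longrightarrow> (\<tau> has_real_derivative 1 / \<delta> (\<gamma> t)) (at t within lifespan T)"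
    and eq: "\<And>t. t \<in> lifespan T \<Longrightarrow> \<gamma>' (\<tau> t) = \<gamma> t"
    using tc by (auto simp: time_changed_iso)
  let ?\<sigma> = "inv_into (lifespan T) \<tau>"
  have cont: "continuous_on (lifespan T) \<tau>"
    using der by (rule DERIV_continuous_on)
  have "(?\<sigma> has_real_derivative \<delta> (\<gamma>' s)) (at s within lifespan T')" and "\<gamma> (?\<sigma> s) = \<gamma>' s"
    if s: "s \<in> lifespan T'" for s
  proof -
    from lifespan_iso_obtain[OF iso s] obtain t where t: "t \<in> lifespan T" "s = \<tau> t" .
    have "(?\<sigma> has_derivative (\<lambda>h. \<delta> (\<gamma> t) * h)) (at (\<tau> t) within \<tau> ` lifespan T)"
    proof (rule has_derivative_inverse_within)
      show "(\<tau> has_derivative (\<lambda>h. 1 / \<delta> (\<gamma> t) * h)) (at t within lifespan T)"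
        using der[OF t(1)] by (simp only: has_field_derivative_def)
      show "continuous (at (\<tau> t) within \<tau> ` lifespan T) ?\<sigma>"
        using lifespan_iso_inverse_continuous[OF iso cont] s t
        by (simp add: lifespan_iso_image[OF iso] continuous_on_eq_continuous_within)
      show "linear (\<lambda>h. \<delta> (\<gamma> t) * h)" by (simp add: linear_times)
      show "(\<lambda>h. \<delta> (\<gamma> t) * h) \<circ> (\<lambda>h. 1 / \<delta> (\<gamma> t) * h) = id"
        using pos[OF t(1)] by (auto simp: fun_eq_iff)
    qed (use t lifespan_iso_inv_into_f[OF iso] in auto)
    then show "(?\<sigma> has_real_derivative \<delta> (\<gamma>' s)) (at s within lifespan T')"
      using t eq by (simp add: has_field_derivative_def lifespan_iso_image[OF iso])
    show "\<gamma> (?\<sigma> s) = \<gamma>' s" using t eq lifespan_iso_inv_into_f[OF iso] by simp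
  qed
  then show ?thesis
    unfolding time_changed_iso
    by (intro exI[of _ ?\<sigma>] conjI lifespan_iso_inv_into[OF iso]) auto
qed

lemma time_changed_continuous:
  assumes tc: "time_changed \<delta> \<gamma> T \<gamma>' T'" and cont: "continuous_on (lifespan T) \<gamma>"
    and pos: "\<And>t. t \<in> lifespan T \<Longrightarrow> 0 < \<delta> (\<gamma> t)"
  shows "continuous_on (lifespan T') \<gamma>'"
proof -
  obtain \<sigma> where iso: "lifespan_iso \<sigma> T' T"
    and der: "\<And>s. s \<in> lifespan T' \<Longrightarrow> (\<sigma> has_real_derivative \<delta> (\<gamma>' s)) (at s within lifespan T')"
    and eq: "\<And>s. s \<in> lifespan T' \<Longrightarrow> \<gamma> (\<sigma> s) = \<gamma>' s"
    using time_changed_sym[OF tc pos] by (auto simp: time_changed_iso)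
  have "continuous_on (lifespan T') (\<lambda>s. \<gamma> (\<sigma> s))"
    using der by (intro continuous_on_compose2[OF cont] DERIV_continuous_on)
      (auto intro: lifespan_iso_mem[OF iso])
  then show ?thesis using eq by (simp cong: continuous_on_cong)
qed

text \<open>The clock is the integral of \<open>h\<close>. Positivity makes it strictly increasing,
  and the intermediate value theorem gives surjectivity onto the lifespan ending at its
  supremum.\<close>

lemma lifespan_iso_exists:
  assumes T: "0 < T" and cont: "continuous_on (lifespan T) h"
    and pos: "\<And>t. t \<in> lifespan T \<Longrightarrow> 0 < h t"
  obtains \<tau> T' where "lifespan_iso \<tau> T T'"
    "\<And>t. t \<in> lifespan T \<Longrightarrow> (\<tau> has_real_derivative h t) (at t within lifespan T)"
proof -
  define \<tau> where "\<tau> t = integral {0..t} h" for t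
  \<comment> \<open>The supremum may be infinite. It is never attained, since every time has a later
    one with larger clock value; hence the image is again half-open.\<close>
  define T' where "T' = (SUP t\<in>lifespan T. ereal (\<tau> t))"
  have der: "(\<tau> has_real_derivative h t) (at t within lifespan T)" if t: "t \<in> lifespan T" for t
  proof -
    obtain b where b: "t < b" "b \<in> lifespan T" using lifespan_beyond[OF t] .
    have "((\<lambda>x. integral {0..x} h) has_real_derivative h t) (at t within {0..b})"
      using b t lifespan_nonneg Icc_subset_lifespan
      by (intro integral_has_real_derivative continuous_on_subset[OF cont]) auto
    then show ?thesis by (simp add: at_within_lifespan[OF b] \<tau>_def[abs_def])
  qed
  have cont\<tau>: "continuous_on (lifespan T) \<tau>" using der by (auto intro: DERIV_continuous_on)
  have mono: "\<tau> s < \<tau> t" if st: "s \<in> lifespan T" "t \<in> lifespan T" "s < t" for s t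
  proof (rule DERIV_pos_imp_increasing_open[OF st(3)])
    show "continuous_on {s..t} \<tau>"
      using st lifespan_nonneg[OF st(1)]
      by (intro continuous_on_subset[OF cont\<tau>]) (auto intro: lifespan_downward[of t])
    fix x assume x: "s < x" "x < t"
    then have xl: "x \<in> lifespan T" using st lifespan_nonneg[OF st(1)] by (auto intro: lifespan_downward)
    have "at x within lifespan T = at x"
      using x st lifespan_nonneg[OF st(1)]
      by (simp add: at_within_lifespan[of x t] at_within_Icc_at)
    then show "\<exists>y. DERIV \<tau> x :> y \<and> 0 < y" using der[OF xl] pos[OF xl] by auto
  qed
  have \<tau>0: "\<tau> 0 = 0" by (simp add: \<tau>_def)
  have image: "\<tau> ` lifespan T = lifespan T'"
  proof (intro equalityI subsetI)
    fix s assume "s \<in> \<tau> ` lifespan T"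
    then obtain t where t: "t \<in> lifespan T" "s = \<tau> t" by auto
    obtain b where b: "t < b" "b \<in> lifespan T" using lifespan_beyond[OF t(1)] .
    have "0 \<le> \<tau> t" using mono[of 0 t] t T \<tau>0 lifespan_nonneg[OF t(1)]
      by (cases "t = 0") (auto simp: zero_in_lifespan)
    moreover have "ereal (\<tau> t) < T'"
      using mono[OF t(1) b(2,1)] b(2) unfolding T'_def by (intro less_SUP_iff[THEN iffD2]) auto
    ultimately show "s \<in> lifespan T'" using t by (simp add: lifespan_def)
  next
    fix s assume s: "s \<in> lifespan T'"
    then have "ereal s < (SUP t\<in>lifespan T. ereal (\<tau> t))" by (simp add: lifespan_def T'_def)
    then obtain b where b: "b \<in> lifespan T" "s < \<tau> b" by (auto simp: less_SUP_iff)
    have "\<exists>x\<ge>0. x \<le> b \<and> \<tau> x = s"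
      using b s \<tau>0 lifespan_nonneg[OF b(1)] lifespan_nonneg[OF s]
      by (intro IVT' continuous_on_subset[OF cont\<tau> Icc_subset_lifespan]) auto
    then show "s \<in> \<tau> ` lifespan T" using b by (auto intro: lifespan_downward)
  qed
  have "inj_on \<tau> (lifespan T)"
    by (rule linorder_inj_onI) (use mono in \<open>auto simp: less_le\<close>)
  then have "lifespan_iso \<tau> T T'"
    unfolding lifespan_iso_def bij_betw_def using image mono by (auto intro: strict_mono_onI)
  then show thesis using der by (rule that)
qed

text \<open>The new trajectory is the old one read through the inverse clock; its values outside the
  new lifespan are irrelevant.\<close>

lemma time_changed_exists:
  assumes "0 < T" "continuous_on (lifespan T) (\<lambda>t. \<delta> (\<gamma> t))"
    and pos: "\<And>t. t \<in> lifespan T \<Longrightarrow> 0 < \<delta> (\<gamma> t)"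
  obtains \<gamma>' T' where "time_changed \<delta> \<gamma> T \<gamma>' T'"
proof -
  have "continuous_on (lifespan T) (\<lambda>t. 1 / \<delta> (\<gamma> t))"
    using assms(2) pos by (auto intro!: continuous_intros dest: pos)
  then obtain \<tau> T' where \<tau>: "lifespan_iso \<tau> T T'"
    "\<And>t. t \<in> lifespan T \<Longrightarrow> (\<tau> has_real_derivative 1 / \<delta> (\<gamma> t)) (at t within lifespan T)"
    using lifespan_iso_exists[OF assms(1), of "\<lambda>t. 1 / \<delta> (\<gamma> t)"] pos
    by (metis zero_less_divide_1_iff)
  then show thesis
    by (intro that[of "\<lambda>s. \<gamma> (inv_into (lifespan T) \<tau> s)" T'])
      (auto simp: time_changed_iso lifespan_iso_inv_into_f intro!: exI[of _ \<tau>])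
qed

text \<open>The chain rule along the inverse clock, whose derivative is \<delta>, turns
  \<open>F\<close> into \<delta> times \<open>F\<close>. The clause for removed conductances
  concerns only the order of times and passes through the increasing clock.\<close>

lemma time_changed_trajectory:
  assumes tr: "trajectory C K F \<gamma> T" and tc: "time_changed \<delta> \<gamma> T \<gamma>' T'"
    and pos: "\<And>\<kappa>. \<kappa> \<in> K \<Longrightarrow> 0 < \<delta> \<kappa>"
    and F': "\<And>\<kappa>. \<kappa> \<in> K \<Longrightarrow> F' \<kappa> = \<delta> \<kappa> *\<^sub>R F \<kappa>"
  shows "trajectory C K F' \<gamma>' T'"
proof -
  have T: "0 < T" and cont: "continuous_on (lifespan T) \<gamma>"
    and K: "\<And>t. t \<in> lifespan T \<Longrightarrow> \<gamma> t \<in> K"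
    using tr by (auto simp: trajectory_def)
  obtain \<sigma> where iso: "lifespan_iso \<sigma> T' T"
    and der: "\<And>s. s \<in> lifespan T' \<Longrightarrow> (\<sigma> has_real_derivative \<delta> (\<gamma>' s)) (at s within lifespan T')"
    and eq: "\<And>s. s \<in> lifespan T' \<Longrightarrow> \<gamma> (\<sigma> s) = \<gamma>' s"
    using time_changed_sym[OF tc] pos K by (auto simp: time_changed_iso)
  show ?thesis unfolding trajectory_def
  proof (intro conjI ballI allI)
    show "0 < T'" by (rule time_changed_pos[OF tc T])
    show "continuous_on (lifespan T') \<gamma>'"
      by (rule time_changed_continuous[OF tc cont]) (simp add: pos K)
  next
    fix s assume s: "s \<in> lifespan T'"
    then have \<sigma>s: "\<sigma> s \<in> lifespan T" by (rule lifespan_iso_mem[OF iso])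
    show \<gamma>s: "\<gamma>' s \<in> K" using K[OF \<sigma>s] eq[OF s] by simp
    fix i
    have tri: "if i \<in> C \<and> \<gamma> (\<sigma> s) $ i = 0
             then \<forall>t\<in>lifespan T. \<sigma> s \<le> t \<longrightarrow> \<gamma> t $ i = 0
             else ((\<lambda>t. \<gamma> t $ i) has_real_derivative F (\<gamma> (\<sigma> s)) $ i) (at (\<sigma> s) within lifespan T)"
      using tr \<sigma>s by (auto simp: trajectory_def)
    show "if i \<in> C \<and> \<gamma>' s $ i = 0
             then \<forall>t\<in>lifespan T'. s \<le> t \<longrightarrow> \<gamma>' t $ i = 0
             else ((\<lambda>s. \<gamma>' s $ i) has_real_derivative F' (\<gamma>' s) $ i) (at s within lifespan T')"
    proof (cases "i \<in> C \<and> \<gamma>' s $ i = 0")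
      case True
      then have "\<forall>t\<in>lifespan T. \<sigma> s \<le> t \<longrightarrow> \<gamma> t $ i = 0" using tri eq[OF s] by auto
      then have "\<forall>t\<in>lifespan T'. s \<le> t \<longrightarrow> \<gamma>' t $ i = 0"
        using lifespan_iso_le[OF iso s] lifespan_iso_mem[OF iso] eq by metis
      then show ?thesis using True by simp
    next
      case False
      then have "((\<lambda>t. \<gamma> t $ i) has_real_derivative F (\<gamma>' s) $ i) (at (\<sigma> s) within \<sigma> ` lifespan T')"
        using tri eq[OF s] by (auto simp: lifespan_iso_image[OF iso])
      from DERIV_image_chain[OF this der[OF s]]
      have "((\<lambda>s. \<gamma> (\<sigma> s) $ i) has_real_derivative F' (\<gamma>' s) $ i) (at s within lifespan T')"
        by (simp add: o_def F'[OF \<gamma>s] mult.commute)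
      then have "((\<lambda>s. \<gamma>' s $ i) has_real_derivative F' (\<gamma>' s) $ i) (at s within lifespan T')"
        by (rule has_field_derivative_transform_within[where d = 1]) (use s eq in auto)
      then show ?thesis using False by auto
    qed
  qed
qed

text \<open>An extension of the time-changed trajectory, run at the original speed, extends the original
  one: both clocks have the same derivative, so the composed clock is the identity.\<close>

lemma time_changed_maximal:
  assumes max: "maximal_trajectory C K F \<gamma> T" and tc: "time_changed \<delta> \<gamma> T \<gamma>' T'"
    and pos: "\<And>\<kappa>. \<kappa> \<in> K \<Longrightarrow> 0 < \<delta> \<kappa>" and cont: "continuous_on K \<delta>"
    and F': "\<And>\<kappa>. \<kappa> \<in> K \<Longrightarrow> F' \<kappa> = \<delta> \<kappa> *\<^sub>R F \<kappa>"
  shows "maximal_trajectory C K F' \<gamma>' T'"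
  unfolding maximal_trajectory_def
proof (intro conjI notI)
  have tr: "trajectory C K F \<gamma> T" using max by (simp add: maximal_trajectory_def)
  then have T: "0 < T" and K: "\<And>t. t \<in> lifespan T \<Longrightarrow> \<gamma> t \<in> K"
    by (auto simp: trajectory_def)
  then have T': "0 < T'" using time_changed_pos[OF tc] by simp
  show "trajectory C K F' \<gamma>' T'" by (rule time_changed_trajectory[OF tr tc pos F'])
  assume "\<exists>\<eta>' S'. T' < S' \<and> trajectory C K F' \<eta>' S' \<and> (\<forall>t\<in>lifespan T'. \<eta>' t = \<gamma>' t)"
  then obtain \<eta>' S' where S': "T' < S'" and tr': "trajectory C K F' \<eta>' S'"
    and ext: "\<And>t. t \<in> lifespan T' \<Longrightarrow> \<eta>' t = \<gamma>' t" by blast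
  have K': "\<eta>' s \<in> K" if "s \<in> lifespan S'" for s using tr' that by (simp add: trajectory_def)
  \<comment> \<open>Positivity and continuity of \<delta> are used on all of \<open>K\<close> here:
    the extension may leave the image of the original trajectory.\<close>
  have cont': "continuous_on (lifespan S') (\<lambda>s. 1 / \<delta> (\<eta>' s))"
    using tr' pos K' by (intro continuous_intros continuous_on_compose2[OF cont])
      (auto simp: trajectory_def dest!: K' pos)
  obtain \<eta> S where tc': "time_changed (\<lambda>\<kappa>. 1 / \<delta> \<kappa>) \<eta>' S' \<eta> S"
    by (rule time_changed_exists[OF _ cont']) (use tr' pos K' in \<open>auto simp: trajectory_def\<close>)
  have trS: "trajectory C K F \<eta> S"
  proof (rule time_changed_trajectory[OF tr' tc'])
    show "F \<kappa> = (1 / \<delta> \<kappa>) *\<^sub>R F' \<kappa>" if "\<kappa> \<in> K" for \<kappa> using F'[OF that] pos[OF that] by simp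
  qed (simp add: pos)
  obtain \<tau> where iso: "lifespan_iso \<tau> T T'"
    and der: "\<And>t. t \<in> lifespan T \<Longrightarrow> (\<tau> has_real_derivative 1 / \<delta> (\<gamma> t)) (at t within lifespan T)"
    and eq: "\<And>t. t \<in> lifespan T \<Longrightarrow> \<gamma>' (\<tau> t) = \<gamma> t"
    using tc by (auto simp: time_changed_iso)
  obtain \<sigma> where iso': "lifespan_iso \<sigma> S' S"
    and der': "\<And>s. s \<in> lifespan S' \<Longrightarrow> (\<sigma> has_real_derivative \<delta> (\<eta>' s)) (at s within lifespan S')"
    and eq': "\<And>s. s \<in> lifespan S' \<Longrightarrow> \<eta> (\<sigma> s) = \<eta>' s"
    using tc' by (auto simp: time_changed_iso)
  have sub: "lifespan T' \<subseteq> lifespan S'" using S' by (auto simp: lifespan_def)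
  have "((\<lambda>t. \<sigma> (\<tau> t) - t) has_real_derivative 0) (at t within lifespan T)"
    if t: "t \<in> lifespan T" for t
  proof -
    have \<tau>t: "\<tau> t \<in> lifespan T'" by (rule lifespan_iso_mem[OF iso t])
    have "(\<sigma> has_real_derivative \<delta> (\<gamma> t)) (at (\<tau> t) within \<tau> ` lifespan T)"
      using DERIV_subset[OF der' sub, of "\<tau> t"] \<tau>t sub ext eq[OF t]
      by (auto simp: lifespan_iso_image[OF iso])
    from DERIV_diff[OF DERIV_image_chain[OF this der[OF t]] DERIV_ident]
    show ?thesis using pos[OF K[OF t]] by (simp add: o_def)
  qed
  then obtain c where "\<forall>t\<in>lifespan T. \<sigma> (\<tau> t) - t = c"
    using has_field_derivative_zero_constant[OF convex_lifespan] by blast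
  moreover have "\<sigma> (\<tau> 0) - 0 = 0"
    using T T' S' by (simp add: lifespan_iso_zero[OF iso] lifespan_iso_zero[OF iso'])
  ultimately have id: "\<sigma> (\<tau> t) = t" if "t \<in> lifespan T" for t
    using zero_in_lifespan[OF T] that by (metis add_cancel_right_left diff_add_cancel)
  have "\<eta> t = \<gamma> t" if "t \<in> lifespan T" for t
    using eq'[of "\<tau> t"] id[OF that] ext eq[OF that] lifespan_iso_mem[OF iso that] sub by auto
  \<comment> \<open>\<open>T'\<close> is finite because it lies below \<open>S'\<close>, so the
    extension is still alive at time \<open>T'\<close>. The clock value there exceeds every time of
    the original lifespan and itself lies strictly below \<open>S\<close>.\<close>
  moreover have "T < S"
  proof -
    obtain r where r: "T' = ereal r" using T' S' by (cases T') auto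
    then have rS: "r \<in> lifespan S'" using T' S' by (simp add: lifespan_def zero_ereal_def)
    have less: "t < \<sigma> r" if "t \<in> lifespan T" for t
    proof -
      have "\<tau> t \<in> lifespan T'" by (rule lifespan_iso_mem[OF iso that])
      then have "\<tau> t < r" "\<tau> t \<in> lifespan S'" using r sub by (auto simp: lifespan_def)
      then show ?thesis using lifespan_iso_less[OF iso' _ rS] id[OF that] by metis
    qed
    have "T \<le> ereal (\<sigma> r)"
    proof (rule ccontr)
      assume "\<not> ?thesis"
      then have "\<sigma> r \<in> lifespan T"
        using lifespan_nonneg[OF lifespan_iso_mem[OF iso' rS]] by (simp add: lifespan_def)
      then show False using less by blast
    qed
    moreover have "ereal (\<sigma> r) < S" using lifespan_iso_mem[OF iso' rS] by (simp add: lifespan_def)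
    ultimately show ?thesis by simp
  qed
  ultimately show False using max trS by (auto simp: maximal_trajectory_def)
qed

text \<open>A sequence of times tending to one end is carried by the clock to a sequence tending to
  the other end, with the same points visited. The inverse clock gives the reverse
  inclusion.\<close>

lemma time_changed_omega_limit_subset:
  assumes tc: "time_changed \<delta> \<gamma> T \<gamma>' T'" and T: "0 < T"
  shows "omega_limit_set \<gamma> T \<subseteq> omega_limit_set \<gamma>' T'"
proof
  fix p assume "p \<in> omega_limit_set \<gamma> T"
  then obtain u where u: "\<And>n. u n \<in> lifespan T" "(\<lambda>n. ereal (u n)) \<longlonglongrightarrow> T" "(\<lambda>n. \<gamma> (u n)) \<longlonglongrightarrow> p"
    by (auto simp: omega_limit_set_def)
  obtain \<tau> where iso: "lifespan_iso \<tau> T T'" and eq: "\<And>t. t \<in> lifespan T \<Longrightarrow> \<gamma>' (\<tau> t) = \<gamma> t"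
    using tc by (auto simp: time_changed_iso)
  show "p \<in> omega_limit_set \<gamma>' T'"
    unfolding omega_limit_set_def
    using u lifespan_iso_mem[OF iso] lifespan_iso_tendsto_end[OF iso T u(1,2)] eq
    by (auto intro!: exI[of _ "\<lambda>n. \<tau> (u n)"])
qed

lemma time_changed_omega_limit:
  assumes "time_changed \<delta> \<gamma> T \<gamma>' T'" "0 < T" "\<And>t. t \<in> lifespan T \<Longrightarrow> 0 < \<delta> (\<gamma> t)"
  shows "omega_limit_set \<gamma>' T' = omega_limit_set \<gamma> T"
  using time_changed_omega_limit_subset[OF assms(1,2)]
    time_changed_omega_limit_subset[OF time_changed_sym[OF assms(1,3)] time_changed_pos[OF assms(1,2)]]
  by blast

lemma time_changed_tendsto:
  assumes tc: "time_changed \<delta> \<gamma> T \<gamma>' T'" and T: "0 < T" and lim: "(\<gamma>' \<longlongrightarrow> p) (time_end T')"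
  shows "(\<gamma> \<longlongrightarrow> p) (time_end T)"
proof -
  obtain \<tau> where iso: "lifespan_iso \<tau> T T'" and eq: "\<And>t. t \<in> lifespan T \<Longrightarrow> \<gamma>' (\<tau> t) = \<gamma> t"
    using tc by (auto simp: time_changed_iso)
  have "((\<lambda>t. \<gamma>' (\<tau> t)) \<longlongrightarrow> p) (time_end T)"
    by (rule filterlim_compose[OF lim lifespan_iso_filterlim[OF iso T]])
  moreover have "\<forall>\<^sub>F t in time_end T. \<gamma>' (\<tau> t) = \<gamma> t"
    using eq zero_in_lifespan[OF T] by (auto simp: eventually_time_end[OF T])
  ultimately show ?thesis by (rule Lim_transform_eventually)
qed

section \<open>Orbits, limit sets and selection under a positive rescaling of the field\<close>

context
  fixes C :: "'m::finite set" and K :: "(real^'m) set" and F F' :: "real^'m \<Rightarrow> real^'m"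
    and \<delta> :: "real^'m \<Rightarrow> real"
  assumes pos: "\<And>\<kappa>. \<kappa> \<in> K \<Longrightarrow> 0 < \<delta> \<kappa>" and cont: "continuous_on K \<delta>"
    and F': "\<And>\<kappa>. \<kappa> \<in> K \<Longrightarrow> F' \<kappa> = \<delta> \<kappa> *\<^sub>R F \<kappa>"
begin

lemma maximal_trajectory_rescaled:
  assumes max: "maximal_trajectory C K F \<gamma> T"
  obtains \<gamma>' T' where "maximal_trajectory C K F' \<gamma>' T'" "time_changed \<delta> \<gamma> T \<gamma>' T'"
    "omega_limit_set \<gamma>' T' = omega_limit_set \<gamma> T"
proof -
  have tr: "trajectory C K F \<gamma> T" using max by (simp add: maximal_trajectory_def)
  then have T: "0 < T" and K: "\<And>t. t \<in> lifespan T \<Longrightarrow> \<gamma> t \<in> K"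
    by (auto simp: trajectory_def)
  have "continuous_on (lifespan T) (\<lambda>t. \<delta> (\<gamma> t))"
    using tr by (intro continuous_on_compose2[OF cont]) (auto simp: trajectory_def)
  then obtain \<gamma>' T' where tc: "time_changed \<delta> \<gamma> T \<gamma>' T'"
    using time_changed_exists[OF T] pos K by metis
  show thesis
    using that[OF time_changed_maximal[OF max tc pos cont F'] tc time_changed_omega_limit[OF tc T]]
      pos K by blast
qed

text \<open>Inclusion is enough: the assumptions of this context are preserved when \<open>F\<close>
  and \<open>F'\<close> are exchanged and \<delta> is replaced by its reciprocal. The same holds for
  the next two lemmas.\<close>

lemma orbits_rescaled: "orbits C K F \<kappa>\<^sub>0 \<subseteq> orbits C K F' \<kappa>\<^sub>0"
proof
  fix O1 assume "O1 \<in> orbits C K F \<kappa>\<^sub>0"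
  then obtain \<gamma> T where O1: "O1 = \<gamma> ` lifespan T" "maximal_trajectory C K F \<gamma> T" "\<gamma> 0 = \<kappa>\<^sub>0"
    by (auto simp: orbits_def)
  have "0 < T" using O1(2) by (simp add: maximal_trajectory_def trajectory_def)
  from O1(2) obtain \<gamma>' T' where *: "maximal_trajectory C K F' \<gamma>' T'" "time_changed \<delta> \<gamma> T \<gamma>' T'"
    by (rule maximal_trajectory_rescaled)
  show "O1 \<in> orbits C K F' \<kappa>\<^sub>0"
    using * O1 time_changed_image[OF *(2)] time_changed_initial[OF *(2) \<open>0 < T\<close>]
    unfolding orbits_def by (intro CollectI exI[of _ \<gamma>'] exI[of _ T']) auto
qed

lemma omega_limit_sets_rescaled: "omega_limit_sets C K F \<kappa>\<^sub>0 \<subseteq> omega_limit_sets C K F' \<kappa>\<^sub>0"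
proof
  fix W assume "W \<in> omega_limit_sets C K F \<kappa>\<^sub>0"
  then obtain \<gamma> T where W: "W = omega_limit_set \<gamma> T" "maximal_trajectory C K F \<gamma> T" "\<gamma> 0 = \<kappa>\<^sub>0"
    by (auto simp: omega_limit_sets_def)
  have "0 < T" using W(2) by (simp add: maximal_trajectory_def trajectory_def)
  from W(2) obtain \<gamma>' T' where *: "maximal_trajectory C K F' \<gamma>' T'" "time_changed \<delta> \<gamma> T \<gamma>' T'"
    "omega_limit_set \<gamma>' T' = omega_limit_set \<gamma> T"
    by (rule maximal_trajectory_rescaled)
  show "W \<in> omega_limit_sets C K F' \<kappa>\<^sub>0"
    using * W time_changed_initial[OF *(2) \<open>0 < T\<close>]
    unfolding omega_limit_sets_def by blast
qed

lemma selected_rescaled: "selected C K F S \<kappa>\<^sub>0 \<subseteq> selected C K F' S \<kappa>\<^sub>0"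
proof
  fix p assume "p \<in> selected C K F S \<kappa>\<^sub>0"
  then obtain \<gamma> T where p: "p \<in> S" "maximal_trajectory C K F \<gamma> T" "\<gamma> 0 = \<kappa>\<^sub>0"
    "(\<gamma> \<longlongrightarrow> p) (time_end T)"
    by (auto simp: selected_def)
  have T: "0 < T" and K: "\<And>t. t \<in> lifespan T \<Longrightarrow> \<gamma> t \<in> K"
    using p(2) by (auto simp: maximal_trajectory_def trajectory_def)
  from p(2) obtain \<gamma>' T' where *: "maximal_trajectory C K F' \<gamma>' T'" "time_changed \<delta> \<gamma> T \<gamma>' T'"
    by (rule maximal_trajectory_rescaled)
  have "time_changed (\<lambda>\<kappa>. 1 / \<delta> \<kappa>) \<gamma>' T' \<gamma> T"
    by (rule time_changed_sym[OF *(2)]) (simp add: pos K)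
  then have "(\<gamma>' \<longlongrightarrow> p) (time_end T')"
    using time_changed_tendsto[OF _ time_changed_pos[OF *(2) T] p(4)] by blast
  then show "p \<in> selected C K F' S \<kappa>\<^sub>0"
    using * p time_changed_initial[OF *(2) T] by (auto simp: selected_def)
qed

end

section \<open>Energies of class C2\<close>

lemma grad_eqI:
  assumes "(f has_derivative (\<lambda>h. h \<bullet> D)) (at x)"
  shows "grad f x = D"
  unfolding grad_def
proof (rule the_equality)
  show "GDERIV f x :> D" using assms by (simp add: gderiv_def)
  fix D' assume "GDERIV f x :> D'"
  then have "(\<lambda>h. h \<bullet> D') = (\<lambda>h. h \<bullet> D)"
    unfolding gderiv_def by (rule has_derivative_unique) (rule assms)
  then show "D' = D" by (simp add: fun_eq_iff vector_eq_ldot)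
qed

lemma has_derivative_grad:
  fixes f :: "real^'n \<Rightarrow> real"
  assumes "f differentiable (at x)"
  shows "(f has_derivative (\<lambda>h. h \<bullet> grad f x)) (at x)"
proof -
  obtain f' where f': "(f has_derivative f') (at x)" using assms by (auto simp: differentiable_def)
  then have lin: "linear f'" by (rule has_derivative_linear)
  \<comment> \<open>The Riesz representative of the linear functional \<open>f'\<close>.\<close>
  define D where "D = adjoint f' 1"
  have "f' = (\<lambda>h. h \<bullet> D)"
    unfolding D_def by (rule ext) (use adjoint_works[OF lin, of _ 1] in simp)
  with f' have *: "(f has_derivative (\<lambda>h. h \<bullet> D)) (at x)" by simp
  show ?thesis unfolding grad_eqI[OF *] by (rule *)
qed

lemma hessian_eqI:
  assumes "(grad f has_derivative (\<lambda>h. A *v h)) (at x)"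
  shows "hessian f x = A"
  unfolding hessian_def jacobian_def frechet_derivative_at[OF assms, symmetric] by simp

lemma C2I:
  assumes f: "\<And>x. (f has_derivative (\<lambda>h. h \<bullet> g x)) (at x)"
    and g: "\<And>x. (g has_derivative (\<lambda>h. A x *v h)) (at x)"
    and A: "continuous_on UNIV A"
  shows "C2 f" and "grad f = g" and "hessian f = A"
proof -
  show grad: "grad f = g" by (rule ext) (rule grad_eqI[OF f])
  show hess: "hessian f = A" by (rule ext) (rule hessian_eqI, unfold grad, rule g)
  show "C2 f" unfolding C2_def grad hess by (intro conjI allI differentiableI[OF f] differentiableI[OF g] A)
qed

lemma C2_has_derivative_grad: "C2 f \<Longrightarrow> (f has_derivative (\<lambda>h. h \<bullet> grad f x)) (at x)"
  by (simp add: C2_def has_derivative_grad)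

lemma C2_has_derivative_hessian:
  "C2 f \<Longrightarrow> (grad f has_derivative (\<lambda>h. hessian f x *v h)) (at x)"
  by (simp add: C2_def hessian_def jacobian_works)

lemma C2_continuous_hessian: "C2 f \<Longrightarrow> continuous_on UNIV (hessian f)"
  by (simp add: C2_def)

lemma C2_continuous: "C2 f \<Longrightarrow> continuous_on UNIV f"
  by (rule continuous_at_imp_continuous_on)
    (blast intro: has_derivative_continuous C2_has_derivative_grad)

lemma sum_matrix_vector_mult: "(\<Sum>i\<in>I. A i) *v x = (\<Sum>i\<in>I. A i *v x)"
  by (induction I rule: infinite_finite_induct) (auto simp: matrix_vector_mult_add_rdistrib)

lemma bounded_linear_matrix_vector_left: "bounded_linear (\<lambda>A. A *v x)" for x :: "real^'n"
  by (intro linear_conv_bounded_linear[THEN iffD1] linearI)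
    (simp_all add: matrix_vector_mult_add_rdistrib scaleR_matrix_vector_assoc)

lemma C2_sum:
  fixes \<Phi> :: "'i \<Rightarrow> real^'n \<Rightarrow> real"
  assumes "\<And>i. C2 (\<Phi> i)"
  shows "C2 (\<lambda>x. \<Sum>i\<in>I. c i * \<Phi> i x)"
    and "grad (\<lambda>x. \<Sum>i\<in>I. c i * \<Phi> i x) = (\<lambda>x. \<Sum>i\<in>I. c i *\<^sub>R grad (\<Phi> i) x)"
    and "hessian (\<lambda>x. \<Sum>i\<in>I. c i * \<Phi> i x) = (\<lambda>x. \<Sum>i\<in>I. c i *\<^sub>R hessian (\<Phi> i) x)"
proof -
  have f: "((\<lambda>x. \<Sum>i\<in>I. c i * \<Phi> i x) has_derivative (\<lambda>h. h \<bullet> (\<Sum>i\<in>I. c i *\<^sub>R grad (\<Phi> i) x))) (at x)"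
    for x
    unfolding inner_sum_right inner_scaleR_right
    by (intro has_derivative_sum has_derivative_mult_right C2_has_derivative_grad assms)
  have g: "((\<lambda>x. \<Sum>i\<in>I. c i *\<^sub>R grad (\<Phi> i) x) has_derivative
      (\<lambda>h. (\<Sum>i\<in>I. c i *\<^sub>R hessian (\<Phi> i) x) *v h)) (at x)" for x
    unfolding sum_matrix_vector_mult scaleR_matrix_vector_assoc[symmetric]
    by (intro has_derivative_sum has_derivative_scaleR_right C2_has_derivative_hessian assms)
  have A: "continuous_on UNIV (\<lambda>x. \<Sum>i\<in>I. c i *\<^sub>R hessian (\<Phi> i) x)"
    by (intro continuous_intros C2_continuous_hessian assms)
  show "C2 (\<lambda>x. \<Sum>i\<in>I. c i * \<Phi> i x)"
    "grad (\<lambda>x. \<Sum>i\<in>I. c i * \<Phi> i x) = (\<lambda>x. \<Sum>i\<in>I. c i *\<^sub>R grad (\<Phi> i) x)"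
    "hessian (\<lambda>x. \<Sum>i\<in>I. c i * \<Phi> i x) = (\<lambda>x. \<Sum>i\<in>I. c i *\<^sub>R hessian (\<Phi> i) x)"
    by (fact C2I[OF f g A])+
qed

section \<open>Second-order calculus along lines\<close>

lemma C2_line_derivative:
  assumes "C2 f"
  shows "((\<lambda>s. f (x + s *\<^sub>R y)) has_real_derivative y \<bullet> grad f (x + s *\<^sub>R y)) (at s)"
proof -
  have "((\<lambda>s. f (x + s *\<^sub>R y)) has_derivative (\<lambda>h. (h *\<^sub>R y) \<bullet> grad f (x + s *\<^sub>R y))) (at s)"
    by (rule has_derivative_compose[OF _ C2_has_derivative_grad[OF assms], of "\<lambda>s. x + s *\<^sub>R y"])
      (auto intro!: derivative_eq_intros)
  then show ?thesis by (rule has_derivative_imp_has_field_derivative) simp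
qed

lemma C2_line_second_derivative:
  assumes "C2 f"
  shows "((\<lambda>s. z \<bullet> grad f (x + s *\<^sub>R y)) has_real_derivative z \<bullet> (hessian f (x + s *\<^sub>R y) *v y)) (at s)"
proof -
  have "((\<lambda>s. grad f (x + s *\<^sub>R y)) has_derivative (\<lambda>h. hessian f (x + s *\<^sub>R y) *v (h *\<^sub>R y))) (at s)"
    by (rule has_derivative_compose[OF _ C2_has_derivative_hessian[OF assms], of "\<lambda>s. x + s *\<^sub>R y"])
      (auto intro!: derivative_eq_intros)
  then have "((\<lambda>s. z \<bullet> grad f (x + s *\<^sub>R y)) has_derivative
      (\<lambda>h. z \<bullet> (hessian f (x + s *\<^sub>R y) *v (h *\<^sub>R y)))) (at s)"
    by (rule has_derivative_inner_right)
  then show ?thesis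
    by (rule has_derivative_imp_has_field_derivative)
      (simp add: matrix_vector_mult_scaleR)
qed

text \<open>The mean value theorem is applied twice, in direction \<open>u\<close> to the increment
  along \<open>v\<close>, then in direction \<open>v\<close> to the directional derivative along
  \<open>u\<close>. The left-hand side is symmetric in \<open>u\<close> and \<open>v\<close>,
  although the right-hand side is not visibly so.\<close>

lemma C2_mixed_difference:
  assumes f: "C2 f" and e: "0 < e"
  obtains a b where "0 < a" "a < e" "0 < b" "b < e"
    "f (x + e *\<^sub>R u + e *\<^sub>R v) - f (x + e *\<^sub>R u) - f (x + e *\<^sub>R v) + f x
      = e\<^sup>2 * (u \<bullet> (hessian f (x + a *\<^sub>R u + b *\<^sub>R v) *v v))"
proof -
  let ?\<phi> = "\<lambda>a. f ((x + e *\<^sub>R v) + a *\<^sub>R u) - f (x + a *\<^sub>R u)"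
  have "\<exists>a>0. a < e \<and> ?\<phi> e - ?\<phi> 0
      = (e - 0) * (u \<bullet> grad f ((x + e *\<^sub>R v) + a *\<^sub>R u) - u \<bullet> grad f (x + a *\<^sub>R u))"
    by (intro MVT2 e DERIV_diff C2_line_derivative f)
  then obtain a where a: "0 < a" "a < e"
    "?\<phi> e - ?\<phi> 0 = (e - 0) * (u \<bullet> grad f ((x + e *\<^sub>R v) + a *\<^sub>R u) - u \<bullet> grad f (x + a *\<^sub>R u))"
    by blast
  let ?\<psi> = "\<lambda>b. u \<bullet> grad f ((x + a *\<^sub>R u) + b *\<^sub>R v)"
  have "\<exists>b>0. b < e \<and>
      ?\<psi> e - ?\<psi> 0 = (e - 0) * (u \<bullet> (hessian f ((x + a *\<^sub>R u) + b *\<^sub>R v) *v v))"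
    by (intro MVT2 e C2_line_second_derivative f)
  then obtain b where b: "0 < b" "b < e"
    "?\<psi> e - ?\<psi> 0 = (e - 0) * (u \<bullet> (hessian f ((x + a *\<^sub>R u) + b *\<^sub>R v) *v v))"
    by blast
  show thesis
    by (rule that[OF a(1,2) b(1,2)])
      (use a(3) b(3) in \<open>simp add: algebra_simps power2_eq_square\<close>)
qed

text \<open>Schwarz's theorem. On squares of side \<open>e n\<close> the second difference can be
  evaluated in either order; dividing by the squared side and letting it shrink gives the claim by
  continuity of the Hessian.\<close>

lemma C2_hessian_inner_commute:
  assumes f: "C2 f"
  shows "u \<bullet> (hessian f x *v v) = v \<bullet> (hessian f x *v u)"
proof -
  define e where "e n = inverse (real (Suc n))" for n
  have e: "0 < e n" for n by (simp add: e_def)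
  have e0: "e \<longlonglongrightarrow> 0" unfolding e_def by (rule LIMSEQ_inverse_real_of_nat)
  have "\<forall>n. \<exists>a b c d. 0 < a \<and> a < e n \<and> 0 < b \<and> b < e n \<and> 0 < c \<and> c < e n \<and> 0 < d \<and> d < e n \<and>
     u \<bullet> (hessian f (x + a *\<^sub>R u + b *\<^sub>R v) *v v) = v \<bullet> (hessian f (x + c *\<^sub>R v + d *\<^sub>R u) *v u)"
  proof
    fix n
    from C2_mixed_difference[OF f e, of n x u v] obtain a b where
      1: "0 < a" "a < e n" "0 < b" "b < e n"
      "f (x + e n *\<^sub>R u + e n *\<^sub>R v) - f (x + e n *\<^sub>R u) - f (x + e n *\<^sub>R v) + f x
        = (e n)\<^sup>2 * (u \<bullet> (hessian f (x + a *\<^sub>R u + b *\<^sub>R v) *v v))" .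
    from C2_mixed_difference[OF f e, of n x v u] obtain c d where
      2: "0 < c" "c < e n" "0 < d" "d < e n"
      "f (x + e n *\<^sub>R v + e n *\<^sub>R u) - f (x + e n *\<^sub>R v) - f (x + e n *\<^sub>R u) + f x
        = (e n)\<^sup>2 * (v \<bullet> (hessian f (x + c *\<^sub>R v + d *\<^sub>R u) *v u))" .
    have swap: "x + e n *\<^sub>R v + e n *\<^sub>R u = x + e n *\<^sub>R u + e n *\<^sub>R v" by simp
    have "(e n)\<^sup>2 * (u \<bullet> (hessian f (x + a *\<^sub>R u + b *\<^sub>R v) *v v))
        = (e n)\<^sup>2 * (v \<bullet> (hessian f (x + c *\<^sub>R v + d *\<^sub>R u) *v u))"
      using 1(5) 2(5) unfolding swap by linarith
    then show "\<exists>a b c d. 0 < a \<and> a < e n \<and> 0 < b \<and> b < e n \<and> 0 < c \<and> c < e n \<and> 0 < d \<and> d < e n \<and>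
       u \<bullet> (hessian f (x + a *\<^sub>R u + b *\<^sub>R v) *v v) = v \<bullet> (hessian f (x + c *\<^sub>R v + d *\<^sub>R u) *v u)"
      using 1 2 e[of n] by (intro exI[of _ a] exI[of _ b] exI[of _ c] exI[of _ d]) auto
  qed
  then obtain a b c d where pos: "\<And>n. 0 < a n \<and> 0 < b n \<and> 0 < c n \<and> 0 < d n"
    and less: "\<And>n. a n < e n \<and> b n < e n \<and> c n < e n \<and> d n < e n"
    and eq: "\<And>n. u \<bullet> (hessian f (x + a n *\<^sub>R u + b n *\<^sub>R v) *v v)
        = v \<bullet> (hessian f (x + c n *\<^sub>R v + d n *\<^sub>R u) *v u)"
    by metis
  have lim0: "s \<longlonglongrightarrow> 0" if "\<And>n. 0 < s n \<and> s n < e n" for s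
    by (rule tendsto_sandwich[OF _ _ tendsto_const e0])
      (use that in \<open>auto intro!: always_eventually intro: less_imp_le\<close>)
  have lim: "(\<lambda>n. z \<bullet> (hessian f (x + s n *\<^sub>R y + t n *\<^sub>R y') *v z')) \<longlonglongrightarrow> z \<bullet> (hessian f x *v z')"
    if "\<And>n. 0 < s n \<and> s n < e n" "\<And>n. 0 < t n \<and> t n < e n" for s t y y' z z'
  proof -
    have "(\<lambda>n. x + s n *\<^sub>R y + t n *\<^sub>R y') \<longlonglongrightarrow> x + 0 *\<^sub>R y + 0 *\<^sub>R y'"
      by (intro tendsto_intros lim0 that)
    then have "(\<lambda>n. hessian f (x + s n *\<^sub>R y + t n *\<^sub>R y')) \<longlonglongrightarrow> hessian f x"
      using continuous_on_tendsto_compose[OF C2_continuous_hessian[OF f]] by fastforce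
    then show ?thesis
      by (intro tendsto_inner tendsto_const bounded_linear.tendsto[OF bounded_linear_matrix_vector_left])
  qed
  show ?thesis
  proof (rule LIMSEQ_unique)
    show "(\<lambda>n. u \<bullet> (hessian f (x + a n *\<^sub>R u + b n *\<^sub>R v) *v v)) \<longlonglongrightarrow> u \<bullet> (hessian f x *v v)"
      using pos less by (intro lim) auto
    show "(\<lambda>n. u \<bullet> (hessian f (x + a n *\<^sub>R u + b n *\<^sub>R v) *v v)) \<longlonglongrightarrow> v \<bullet> (hessian f x *v u)"
      unfolding eq using pos less by (intro lim) auto
  qed
qed

text \<open>If the second derivative along the line were negative, the first derivative, zero at the
  minimum, would be negative just to the right, and the mean value theorem would produce a smaller
  value.\<close>

lemma C2_min_along_line:
  assumes f: "C2 f" and min: "\<And>s. f x \<le> f (x + s *\<^sub>R y)"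
  shows "0 \<le> y \<bullet> (hessian f x *v y)"
proof (rule ccontr)
  assume "\<not> ?thesis"
  then have neg: "y \<bullet> (hessian f x *v y) < 0" by simp
  let ?\<phi> = "\<lambda>s. f (x + s *\<^sub>R y)" and ?\<phi>' = "\<lambda>s. y \<bullet> grad f (x + s *\<^sub>R y)"
  have \<phi>'0: "?\<phi>' 0 = 0"
    by (rule DERIV_local_min[OF C2_line_derivative[OF f, of x y 0], of 1]) (use min in auto)
  have "DERIV ?\<phi>' 0 :> y \<bullet> (hessian f x *v y)"
    using C2_line_second_derivative[OF f, of y x y 0] by simp
  from DERIV_neg_dec_right[OF this neg]
  obtain d where d: "0 < d" "\<And>h. 0 < h \<Longrightarrow> h < d \<Longrightarrow> ?\<phi>' h < ?\<phi>' 0" by auto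
  obtain z where z: "0 < z" "z < d / 2" "?\<phi> (d / 2) - ?\<phi> 0 = (d / 2 - 0) * ?\<phi>' z"
    using MVT2[of 0 "d / 2" ?\<phi> ?\<phi>'] C2_line_derivative[OF f] d(1) by auto
  have "?\<phi>' z < 0" using d(2)[of z] z d(1) \<phi>'0 by auto
  then have "?\<phi> (d / 2) < f x" using z(3) d(1) mult_pos_neg[of "d/2" "?\<phi>' z"] by simp
  then show False using min[of "d / 2"] by simp
qed

lemma outer_product_mult: "(\<chi> i j. d $ i * d $ j) *v h = (d \<bullet> h) *\<^sub>R d" for d :: "real^'n"
  by (simp add: vec_eq_iff matrix_vector_mult_def inner_vec_def sum_distrib_left sum_distrib_right ac_simps)

text \<open>The features of a linear circuit, with \<open>d\<close> an incidence vector. Their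
  constant Hessians are the rank-one terms of the Laplacian.\<close>

lemma half_square_derivatives:
  fixes d :: "real^'n"
  defines "\<Phi> \<equiv> \<lambda>x. 1/2 * (d \<bullet> x)\<^sup>2"
  shows "C2 \<Phi>" and "hessian \<Phi> x = (\<chi> i j. d $ i * d $ j)"
proof -
  have f: "(\<Phi> has_derivative (\<lambda>h. h \<bullet> ((d \<bullet> x) *\<^sub>R d))) (at x)" for x
    unfolding \<Phi>_def by (auto intro!: derivative_eq_intros simp: inner_commute)
  have g: "((\<lambda>x. (d \<bullet> x) *\<^sub>R d) has_derivative (\<lambda>h. (\<chi> i j. d $ i * d $ j) *v h)) (at x)" for x
    unfolding outer_product_mult by (auto intro!: derivative_eq_intros)
  show "C2 \<Phi>" "hessian \<Phi> x = (\<chi> i j. d $ i * d $ j)"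
    using C2I(1,3)[OF f g continuous_on_const] by auto
qed

section \<open>The constrained resolvent\<close>

declare transpose_matrix_vector [simp del]

lemma matrix_entry_inner: "A $ i $ j = axis i 1 \<bullet> (A *v axis j 1)" for A :: "real^'a^'b"
  by (simp add: matrix_vector_mult_basis column_def inner_axis')

lemma symmetric_matrixI:
  fixes A :: "real^'n^'n"
  assumes "\<And>u v. u \<bullet> (A *v v) = v \<bullet> (A *v u)"
  shows "transpose A = A"
  by (simp add: vec_eq_iff transpose_def matrix_entry_inner[of A] assms)

text \<open>A zero of a nonnegative quadratic form is a minimum, so moving from \<open>x\<close> in
  the direction \<open>A *v x\<close> cannot decrease the form.\<close>

lemma psd_zero_quadratic_form:
  fixes A :: "real^'n^'n"
  assumes sym: "\<And>u v. u \<bullet> (A *v v) = v \<bullet> (A *v u)"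
    and psd: "\<And>u. 0 \<le> u \<bullet> (A *v u)" and zero: "x \<bullet> (A *v x) = 0"
  shows "A *v x = 0"
proof -
  let ?y = "A *v x"
  let ?a = "?y \<bullet> ?y" and ?b = "?y \<bullet> (A *v ?y)"
  \<comment> \<open>The summand 1 keeps the denominator positive, since \<open>?b\<close> may
    vanish. With this step length the form collapses to minus \<open>t\<^sup>2 * (?b + 2)\<close>,
    which forces \<open>t = 0\<close>.\<close>
  define t where "t = - (?a / (?b + 1))"
  have b: "0 \<le> ?b" by (rule psd)
  then have a: "?a = - t * (?b + 1)" by (simp add: t_def)
  have "0 \<le> (x + t *\<^sub>R ?y) \<bullet> (A *v (x + t *\<^sub>R ?y))" by (rule psd)
  also have "\<dots> = 2 * t * ?a + t\<^sup>2 * ?b"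
    using zero sym[of x ?y]
    by (simp add: matrix_vector_right_distrib matrix_vector_mult_scaleR inner_add_left inner_add_right
        power2_eq_square algebra_simps)
  also have "\<dots> = - (t\<^sup>2 * (?b + 2))"
    unfolding a by (simp add: power2_eq_square algebra_simps)
  finally have "t = 0" using b by (simp add: mult_le_0_iff)
  then have "?a = 0" using a by simp
  then show ?thesis by simp
qed

lemma transpose_matrix_inner: "(A *v x) \<bullet> y = x \<bullet> (transpose A *v y)"
  for A :: "real^'a^'b"
  by (metis dot_lmul_matrix inner_commute transpose_matrix_vector)

text \<open>Distinct inputs give distinct basis vectors as columns. Consequently
  \<open>P ** transpose P\<close> is the orthogonal projection onto the range of
  \<open>P\<close>.\<close>

lemma input_matrix_isometry:
  assumes "inj inp"
  shows "transpose (input_matrix inp :: real^'p^'n) ** input_matrix inp = mat 1"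
proof -
  have "(\<Sum>k\<in>UNIV. (if k = inp i then 1 else 0) * (if k = inp j then 1 else 0)) = (if i = j then 1 else 0 :: real)"
    for i j
    using assms by (auto simp: inj_eq if_distrib[of "\<lambda>x. x * _"] cong: if_cong)
  then show ?thesis
    by (simp add: input_matrix_def transpose_def matrix_matrix_mult_def mat_def vec_eq_iff)
qed

lemma input_matrix_range_support:
  assumes "i \<notin> range inp"
  shows "((input_matrix inp :: real^'p^'n) *v \<mu>) $ i = 0"
  using assms by (auto simp: input_matrix_def matrix_vector_mult_def intro!: sum.neutral)

text \<open>A column in the range of the input matrix is supported on input nodes, where
  \<open>Q\<close> vanishes; it would be zero, against injectivity of \<open>Q\<close>.\<close>

lemma output_column_not_input:
  fixes Q :: "real^'o^'n" and inp :: "'p::finite \<Rightarrow> 'n"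
  assumes "output_matrix (range inp) Q"
  shows "column k Q \<notin> range ((*v) (input_matrix inp))"
proof
  assume "column k Q \<in> range ((*v) (input_matrix inp))"
  then obtain \<mu> where \<mu>: "column k Q = input_matrix inp *v \<mu>" by auto
  have "column k Q $ i = 0" for i
  proof (cases "i \<in> range inp")
    case True
    then show ?thesis using assms by (auto simp: output_matrix_def column_def)
  qed (simp add: \<mu> input_matrix_range_support)
  then have "Q *v axis k 1 = Q *v 0" by (simp add: matrix_vector_mult_basis vec_eq_iff)
  moreover have "inj ((*v) Q)" using assms by (simp add: output_matrix_def)
  ultimately have "axis k 1 = (0 :: real^'o)" by (rule injD[rotated])
  then show False by (simp add: axis_eq_0_iff)
qed

text \<open>In the block decomposition along \<open>range P \<oplus> ker P\<^sup>T\<close> this is the compression of \<open>H\<close> to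
  \<open>ker P\<^sup>T\<close>, completed by the identity on \<open>range P\<close>.\<close>

definition compressed_hessian :: "real^'p^'n \<Rightarrow> real^'n^'n \<Rightarrow> real^'n^'n" where
  "compressed_hessian P H = (mat 1 - P ** transpose P) ** H ** (mat 1 - P ** transpose P) + P ** transpose P"

context
  fixes P :: "real^'p^'n"
  assumes PtP: "transpose P ** P = mat 1"
begin

lemma transpose_input_mult: "transpose P *v (P *v \<mu>) = \<mu>"
  by (simp add: matrix_vector_mul_assoc PtP)

lemma compressed_hessian_apply:
  "compressed_hessian P H *v y =
    (let z = H *v (y - P *v (transpose P *v y)) in z - P *v (transpose P *v z)) + P *v (transpose P *v y)"
  by (simp add: compressed_hessian_def Let_def matrix_vector_mult_add_rdistrib
      matrix_vector_mult_diff_rdistrib matrix_vector_mul_assoc[symmetric])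

text \<open>Eliminates the multiplier: the two orthogonal components of the square system encode the
  constraint and the force balance modulo the range of \<open>P\<close>. Determinants then become
  available.\<close>

lemma resolvent_solution_iff:
  "resolvent_solution H P f y \<longleftrightarrow> compressed_hessian P H *v y = f - P *v (transpose P *v f)"
proof
  assume "resolvent_solution H P f y"
  then obtain \<mu> where "H *v y + P *v \<mu> = f" "transpose P *v y = 0"
    by (auto simp: resolvent_solution_def)
  then show "compressed_hessian P H *v y = f - P *v (transpose P *v f)"
    by (auto simp: compressed_hessian_apply Let_def matrix_vector_right_distrib transpose_input_mult)
next
  let ?g = "transpose P *v f"
  let ?z = "H *v (y - P *v (transpose P *v y))"
  assume eq: "compressed_hessian P H *v y = f - P *v ?g"
  then have "transpose P *v (compressed_hessian P H *v y) = 0"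
    by (simp add: matrix_vector_mult_diff_distrib transpose_input_mult)
  then have y: "transpose P *v y = 0"
    by (simp add: compressed_hessian_apply Let_def matrix_vector_right_distrib
        matrix_vector_mult_diff_distrib transpose_input_mult)
  \<comment> \<open>The multiplier is the coordinate vector, in the columns of \<open>P\<close>, of
    the unbalanced force \<open>f - H *v y\<close>.\<close>
  have "H *v y + P *v (?g - transpose P *v (H *v y)) = f"
    using eq y by (simp add: compressed_hessian_apply Let_def matrix_vector_mult_diff_distrib algebra_simps)
  with y show "resolvent_solution H P f y" by (auto simp: resolvent_solution_def)
qed

lemma resolvent_solution_unique_iff_det:
  "(\<forall>f. \<exists>!y. resolvent_solution H P f y) \<longleftrightarrow> det (compressed_hessian P H) \<noteq> 0"
proof
  assume unique: "\<forall>f. \<exists>!y. resolvent_solution H P f y"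
  have "\<forall>y. compressed_hessian P H *v y = 0 \<longrightarrow> y = 0"
  proof (intro allI impI)
    fix y assume "compressed_hessian P H *v y = 0"
    then have "resolvent_solution H P 0 y" by (simp add: resolvent_solution_iff)
    moreover have "resolvent_solution H P 0 0" by (simp add: resolvent_solution_iff)
    ultimately show "y = 0" using unique by blast
  qed
  then show "det (compressed_hessian P H) \<noteq> 0"
    by (simp add: invertible_det_nz[symmetric] invertible_left_inverse matrix_left_invertible_ker)
next
  assume "det (compressed_hessian P H) \<noteq> 0"
  then show "\<forall>f. \<exists>!y. resolvent_solution H P f y"
    by (simp add: resolvent_solution_iff cramer)
qed

end

locale unique_resolvent =
  fixes P :: "real^'p^'n" and H :: "real^'n^'n" and R :: "real^'n^'n"
  assumes isometry: "transpose P ** P = mat 1"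
    and unique: "\<And>f. \<exists>!y. resolvent_solution H P f y"
    and R: "R = matrix (\<lambda>f. THE y. resolvent_solution H P f y)"
begin

lemma det_nonzero: "det (compressed_hessian P H) \<noteq> 0"
  using unique resolvent_solution_unique_iff_det[OF isometry] by blast

text \<open>\<open>R\<close> is the matrix of a function given by definite description, and
  \<open>matrix\<close> represents a function only if it is linear. Linearity follows from
  uniqueness, since solutions add and scale.\<close>

lemma solution: "resolvent_solution H P f (R *v f)"
proof -
  let ?s = "\<lambda>f. THE y. resolvent_solution H P f y"
  have s: "resolvent_solution H P f (?s f)" for f using unique by (rule theI')
  have s_eq: "?s f = y" if "resolvent_solution H P f y" for f y
    using unique[of f] that s by blast
  have "linear ?s"
  proof (rule linearI)
    fix f g c
    show "?s (f + g) = ?s f + ?s g"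
      using s[of f] s[of g]
      by (intro s_eq) (simp add: resolvent_solution_iff[OF isometry] matrix_vector_right_distrib)
    show "?s (c *\<^sub>R f) = c *\<^sub>R ?s f"
      using s[of f]
      by (intro s_eq) (simp add: resolvent_solution_iff[OF isometry] matrix_vector_mult_scaleR
          scaleR_right_diff_distrib)
  qed
  then have "R *v f = ?s f" unfolding R by (metis matrix_vector_mul)
  then show ?thesis using s by simp
qed

text \<open>No description operator is left on the right: \<open>H\<close> enters only through
  determinants of entries of the compressed Hessian, so continuity in \<open>H\<close> can be read
  off.\<close>

lemma cramer_formula:
  "R *v f = (\<chi> k. det (\<chi> i j. if j = k then (f - P *v (transpose P *v f)) $ i
      else compressed_hessian P H $ i $ j) / det (compressed_hessian P H))"
  using solution[of f] unfolding resolvent_solution_iff[OF isometry] cramer[OF det_nonzero] .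

lemma constrained: "transpose P *v (R *v f) = 0"
  using solution by (auto simp: resolvent_solution_def)

text \<open>The multiplier force lies in the range of \<open>P\<close> and is orthogonal to every
  admissible \<open>z\<close>.\<close>

lemma inner_solution: "z \<bullet> f = z \<bullet> (H *v (R *v f))" if "transpose P *v z = 0"
proof -
  obtain \<mu> where "H *v (R *v f) + P *v \<mu> = f" using solution[of f] by (auto simp: resolvent_solution_def)
  then have "z \<bullet> f = z \<bullet> (H *v (R *v f)) + z \<bullet> (P *v \<mu>)" by (metis inner_add_right)
  also have "z \<bullet> (P *v \<mu>) = 0"
    using that by (simp add: inner_commute[of z] transpose_matrix_inner)
  finally show ?thesis by simp
qed

lemma kernel: "{f. R *v f = 0} = range ((*v) P)"
proof (intro equalityI subsetI)
  fix f assume "f \<in> {f. R *v f = 0}"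
  then show "f \<in> range ((*v) P)" using solution[of f] by (auto simp: resolvent_solution_def)
next
  fix f assume "f \<in> range ((*v) P)"
  then have "resolvent_solution H P f 0" by (auto simp: resolvent_solution_def)
  then show "f \<in> {f. R *v f = 0}" using unique solution by auto
qed

end

text \<open>Only semidefiniteness on the constraint space is required, which is what second-order
  minimality yields. Strictness comes back through uniqueness, in the form of the kernel of
  \<open>R\<close>.\<close>

locale psd_resolvent = unique_resolvent +
  assumes symmetric: "\<And>u v. u \<bullet> (H *v v) = v \<bullet> (H *v u)"
    and psd: "\<And>y. transpose P *v y = 0 \<Longrightarrow> 0 \<le> y \<bullet> (H *v y)"
begin

text \<open>Both sides equal the \<open>H\<close>-form evaluated at \<open>R *v f\<close> and
  \<open>R *v g\<close>.\<close>

lemma resolvent_inner_commute: "f \<bullet> (R *v g) = g \<bullet> (R *v f)"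
proof -
  have "f \<bullet> (R *v g) = (R *v g) \<bullet> (H *v (R *v f))"
    using inner_solution[OF constrained, of g f] by (simp add: inner_commute)
  also have "\<dots> = (R *v f) \<bullet> (H *v (R *v g))" by (rule symmetric)
  also have "\<dots> = g \<bullet> (R *v f)"
    using inner_solution[OF constrained, of f g] by (simp add: inner_commute)
  finally show ?thesis .
qed

lemma transpose_resolvent: "transpose R = R"
  by (rule symmetric_matrixI) (rule resolvent_inner_commute)

lemma resolvent_psd: "0 \<le> f \<bullet> (R *v f)"
  using psd[OF constrained, of f] inner_solution[OF constrained, of f f] by (simp add: inner_commute)

text \<open>If the form of \<open>R\<close> vanished at \<open>q\<close>, semidefiniteness would
  give \<open>R *v q = 0\<close>, and the kernel of \<open>R\<close> is the range of
  \<open>P\<close>.\<close>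

lemma resolvent_pos: "q \<notin> range ((*v) P) \<Longrightarrow> 0 < q \<bullet> (R *v q)"
  using psd_zero_quadratic_form[OF resolvent_inner_commute resolvent_psd, of q] resolvent_psd[of q] kernel
  by (auto simp: less_le)

end

section \<open>Continuity of the free state and the resolvent\<close>

text \<open>The midpoint of two distinct minimizers would have a smaller value.\<close>

lemma strict_minimizer_unique:
  assumes "strictly_convex_on S f" "m \<in> S" "\<And>x. x \<in> S \<Longrightarrow> f m \<le> f x" "x \<in> S" "f x \<le> f m"
  shows "x = m"
proof (rule ccontr)
  assume "x \<noteq> m"
  have "\<forall>u. x \<noteq> m \<and> 0 < u \<and> u < 1 \<longrightarrow>
      f ((1 - u) *\<^sub>R x + u *\<^sub>R m) < (1 - u) * f x + u * f m"
    using assms(1,2,4) unfolding strictly_convex_on_def by blast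
  from spec[OF this, of "1/2"] \<open>x \<noteq> m\<close>
  have "f ((1 - 1/2) *\<^sub>R x + (1/2) *\<^sub>R m) < (1 - 1/2) * f x + 1/2 * f m" by simp
  moreover have "(1 - 1/2) *\<^sub>R x + (1/2) *\<^sub>R m \<in> S"
    using assms(1,2,4) by (auto simp: strictly_convex_on_def intro: convexD)
  ultimately show False using assms(3)[of "(1 - 1/2) *\<^sub>R x + (1/2) *\<^sub>R m"] assms(5) by simp
qed

text \<open>If minimizers stayed away from \<open>m \<kappa>\<^sub>0\<close> along a sequence \<open>\<kappa>\<^sub>n \<rightarrow> \<kappa>\<^sub>0\<close>, convexity would give points on a
  fixed sphere around \<open>m \<kappa>\<^sub>0\<close> at which \<open>f \<kappa>\<^sub>n\<close> does not exceed \<open>f \<kappa>\<^sub>n (m \<kappa>\<^sub>0)\<close>; a limit point of these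
  would be a second minimizer of \<open>f \<kappa>\<^sub>0\<close>.\<close>

lemma continuous_on_strict_minimizer:
  fixes f :: "'a::metric_space \<Rightarrow> real^'n \<Rightarrow> real"
  assumes cont: "continuous_on (K \<times> UNIV) (\<lambda>(\<kappa>, x). f \<kappa> x)" and S: "closed S"
    and convex: "\<And>\<kappa>. \<kappa> \<in> K \<Longrightarrow> strictly_convex_on S (f \<kappa>)"
    and m: "\<And>\<kappa>. \<kappa> \<in> K \<Longrightarrow> m \<kappa> \<in> S" and min: "\<And>\<kappa> x. \<kappa> \<in> K \<Longrightarrow> x \<in> S \<Longrightarrow> f \<kappa> (m \<kappa>) \<le> f \<kappa> x"
  shows "continuous_on K m"
  unfolding continuous_on_iff
proof (intro ballI allI impI)
  fix \<kappa>\<^sub>0 and e :: real assume \<kappa>\<^sub>0: "\<kappa>\<^sub>0 \<in> K" and e: "0 < e"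
  let ?m = "m \<kappa>\<^sub>0"
  show "\<exists>d>0. \<forall>\<kappa>\<in>K. dist \<kappa> \<kappa>\<^sub>0 < d \<longrightarrow> dist (m \<kappa>) ?m < e"
  proof (rule ccontr)
    assume no: "\<not> ?thesis"
    have "\<forall>n. \<exists>\<kappa>. \<kappa> \<in> K \<and> dist \<kappa> \<kappa>\<^sub>0 < inverse (real (Suc n)) \<and> e \<le> dist (m \<kappa>) ?m"
    proof
      fix n
      have "0 < inverse (real (Suc n))" by simp
      with no have "\<not> (\<forall>\<kappa>\<in>K. dist \<kappa> \<kappa>\<^sub>0 < inverse (real (Suc n)) \<longrightarrow> dist (m \<kappa>) ?m < e)" by blast
      then show "\<exists>\<kappa>. \<kappa> \<in> K \<and> dist \<kappa> \<kappa>\<^sub>0 < inverse (real (Suc n)) \<and> e \<le> dist (m \<kappa>) ?m"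
        by (auto simp: not_less)
    qed
    then obtain k where k: "\<And>n. k n \<in> K" "\<And>n. dist (k n) \<kappa>\<^sub>0 < inverse (real (Suc n))"
      "\<And>n. e \<le> dist (m (k n)) ?m" by metis
    have klim: "k \<longlonglongrightarrow> \<kappa>\<^sub>0"
      by (rule tendsto_dist_iff[THEN iffD2], rule tendsto_sandwich[OF _ _ tendsto_const
            LIMSEQ_inverse_real_of_nat]) (use k(2) in \<open>auto intro!: always_eventually intro: less_imp_le\<close>)
    \<comment> \<open>The fraction of the segment from \<open>?m\<close> to \<open>m (k n)\<close>
      that ends on the sphere of radius \<open>e\<close>; it is at most 1 because the segment has
      length at least \<open>e\<close>.\<close>
    define u where "u n = e / dist (m (k n)) ?m" for n
    define x where "x n = (1 - u n) *\<^sub>R ?m + u n *\<^sub>R m (k n)" for n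
    have u: "0 < u n" "u n \<le> 1" for n
    proof -
      have "0 < dist (m (k n)) ?m" using k(3)[of n] e by linarith
      then show "0 < u n" "u n \<le> 1" using k(3)[of n] e by (auto simp: u_def)
    qed
    have xS: "x n \<in> S" for n
      using convex[OF \<kappa>\<^sub>0] m[OF \<kappa>\<^sub>0] m[OF k(1)[of n]] u[of n] unfolding x_def strictly_convex_on_def
      by (intro convexD) auto
    have xdist: "dist (x n) ?m = e" for n
    proof -
      have "x n - ?m = u n *\<^sub>R (m (k n) - ?m)" by (simp add: x_def algebra_simps)
      then have "dist (x n) ?m = u n * dist (m (k n)) ?m" using u(1)[of n] by (simp add: dist_norm)
      then show ?thesis using k(3)[of n] e by (auto simp: u_def)
    qed
    have xle: "f (k n) (x n) \<le> f (k n) ?m" for n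
    \<comment> \<open>Strict convexity speaks only of interior points of a segment; for
      \<open>u n = 1\<close> the point \<open>x n\<close> is the minimizer itself.\<close>
    proof (cases "u n = 1")
      case True
      then show ?thesis using min[OF k(1) m[OF \<kappa>\<^sub>0]] by (simp add: x_def)
    next
      case False
      have "?m \<noteq> m (k n)" using k(3)[of n] e by auto
      then have "f (k n) (x n) < (1 - u n) * f (k n) ?m + u n * f (k n) (m (k n))"
        using convex[OF k(1)[of n]] m[OF \<kappa>\<^sub>0] m[OF k(1)[of n]] u[of n] False
        unfolding x_def strictly_convex_on_def by auto
      also have "\<dots> \<le> (1 - u n) * f (k n) ?m + u n * f (k n) ?m"
        using min[OF k(1) m[OF \<kappa>\<^sub>0], of n] u[of n] by simp
      finally show ?thesis by (simp add: algebra_simps)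
    qed
    have "compact (S \<inter> sphere ?m e)" using S by (simp add: closed_Int_compact)
    moreover have "\<forall>n. x n \<in> S \<inter> sphere ?m e" using xS xdist by (simp add: dist_commute)
    ultimately obtain l r where l: "l \<in> S \<inter> sphere ?m e" and r: "strict_mono r" "(x \<circ> r) \<longlonglongrightarrow> l"
      unfolding compact_def by metis
    have klim': "(\<lambda>n. k (r n)) \<longlonglongrightarrow> \<kappa>\<^sub>0" using LIMSEQ_subseq_LIMSEQ[OF klim r(1)] by (simp add: o_def)
    have flim: "(\<lambda>n. f (k (r n)) (z n)) \<longlonglongrightarrow> f \<kappa>\<^sub>0 y" if "z \<longlonglongrightarrow> y" for z y
      using continuous_on_tendsto_compose[OF cont tendsto_Pair[OF klim' that]] \<kappa>\<^sub>0 k(1) by simp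
    have "f \<kappa>\<^sub>0 l \<le> f \<kappa>\<^sub>0 ?m"
      by (rule LIMSEQ_le[OF flim[OF r(2)] flim[OF tendsto_const]]) (use xle in auto)
    then have "l = ?m"
      using strict_minimizer_unique[OF convex[OF \<kappa>\<^sub>0] m[OF \<kappa>\<^sub>0] min[OF \<kappa>\<^sub>0]] l by blast
    then show False using l e by simp
  qed
qed

section \<open>Continuous dependence of free state, Hessian and resolvent on the parameters\<close>

lemma continuous_on_det:
  fixes A :: "'a::topological_space \<Rightarrow> real^'n^'n"
  assumes "\<And>i j. continuous_on S (\<lambda>x. A x $ i $ j)"
  shows "continuous_on S (\<lambda>x. det (A x))"
  unfolding det_def by (intro continuous_intros assms)

lemma continuous_on_compressed_hessian:
  assumes "continuous_on S H"
  shows "continuous_on S (\<lambda>x. compressed_hessian P (H x))"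
  unfolding compressed_hessian_def matrix_matrix_mult_def
  by (simp, intro continuous_intros continuous_on_vec_lambda assms)

lemma closed_input_surface: "closed (input_surface P v)"
  unfolding input_surface_def
  by (intro closed_Collect_eq continuous_intros
      linear_continuous_on matrix_vector_mul_bounded_linear)

lemma free_state_arg_min:
  assumes "has_free_state G P v \<kappa>"
  shows "free_state G P v \<kappa> \<in> input_surface P v"
    and "x \<in> input_surface P v \<Longrightarrow> G \<kappa> (free_state G P v \<kappa>) \<le> G \<kappa> x"
proof -
  have "is_arg_min (G \<kappa>) (\<lambda>x. x \<in> input_surface P v) (free_state G P v \<kappa>)"
    using assms unfolding has_free_state_def free_state_def arg_min_on_def arg_min_def by (rule someI_ex)
  then show "free_state G P v \<kappa> \<in> input_surface P v"
    "x \<in> input_surface P v \<Longrightarrow> G \<kappa> (free_state G P v \<kappa>) \<le> G \<kappa> x"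
    by (auto simp: is_arg_min_linorder)
qed

locale separable_network =
  fixes C :: "'m::finite set" and K :: "(real^'m) set" and g :: "'m \<Rightarrow> real \<Rightarrow> real"
    and \<Phi> :: "'m \<Rightarrow> real^'n \<Rightarrow> real" and P :: "real^'p^'n" and v :: "real^'p"
    and G :: "real^'m \<Rightarrow> real^'n \<Rightarrow> real"
  assumes isometry: "transpose P ** P = mat 1"
    and regular: "regular_separable C g \<Phi>" and G: "G = separable_energy g \<Phi>"
    and nonneg: "\<And>\<kappa> i. \<kappa> \<in> K \<Longrightarrow> i \<in> C \<Longrightarrow> 0 \<le> \<kappa> $ i"
    and convex: "\<And>\<kappa>. \<kappa> \<in> K \<Longrightarrow> strictly_convex_on (input_surface P v) (G \<kappa>)"
    and free: "\<And>\<kappa>. \<kappa> \<in> K \<Longrightarrow> has_free_state G P v \<kappa>"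
    and solvable: "\<And>\<kappa>. \<kappa> \<in> K \<Longrightarrow> has_resolvent G P v \<kappa>"
begin

lemma C2_feature: "C2 (\<Phi> i)"
  using regular by (simp add: regular_separable_def)

lemma C2_energy: "C2 (G \<kappa>)" and hessian_energy: "hessian (G \<kappa>) x = (\<Sum>i\<in>UNIV. g i (\<kappa> $ i) *\<^sub>R hessian (\<Phi> i) x)"
proof -
  have "G \<kappa> = (\<lambda>x. \<Sum>i\<in>UNIV. g i (\<kappa> $ i) * \<Phi> i x)" by (simp add: G separable_energy_def fun_eq_iff)
  then show "C2 (G \<kappa>)" "hessian (G \<kappa>) x = (\<Sum>i\<in>UNIV. g i (\<kappa> $ i) *\<^sub>R hessian (\<Phi> i) x)"
    using C2_sum[of \<Phi>, OF C2_feature] by simp_all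
qed

text \<open>For conductances continuity is known only on \<open>{0..}\<close>, up to and including
  the removal value 0; the values on \<open>K\<close> stay there by \<open>nonneg\<close>.\<close>

lemma continuous_on_coefficient: "continuous_on K (\<lambda>\<kappa>. g i (\<kappa> $ i))"
proof (cases "i \<in> C")
  case True
  then have "continuous_on {0..} (g i)" using regular unfolding regular_separable_def by metis
  then show ?thesis
    by (rule continuous_on_compose2) (use nonneg True in \<open>auto intro!: continuous_intros\<close>)
next
  case False
  then have "\<forall>c. g i differentiable (at c)" using regular unfolding regular_separable_def by metis
  then have "continuous_on UNIV (g i)"
    by (auto intro!: continuous_at_imp_continuous_on differentiable_imp_continuous_within)
  then show ?thesis
    by (rule continuous_on_compose2) (auto intro!: continuous_intros)
qed

lemma continuous_on_energy: "continuous_on (K \<times> UNIV) (\<lambda>(\<kappa>, x). G \<kappa> x)"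
  unfolding G separable_energy_def split_def
proof (intro continuous_on_sum continuous_on_mult)
  show "continuous_on (K \<times> UNIV) (\<lambda>p. g i (fst p $ i))" for i
    by (rule continuous_on_compose2[OF continuous_on_coefficient continuous_on_fst[OF continuous_on_id]])
      auto
  show "continuous_on (K \<times> UNIV) (\<lambda>p. \<Phi> i (snd p))" for i
    by (rule continuous_on_compose2[OF C2_continuous[OF C2_feature] continuous_on_snd[OF continuous_on_id]])
      auto
qed

lemma continuous_on_free_state: "continuous_on K (free_state G P v)"
  by (rule continuous_on_strict_minimizer[OF continuous_on_energy closed_input_surface convex
        free_state_arg_min[OF free]])

lemma continuous_on_free_hessian: "continuous_on K (free_hessian G P v)"
  unfolding free_hessian_def hessian_energy
proof (intro continuous_on_sum continuous_on_scaleR continuous_on_coefficient)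
  show "continuous_on K (\<lambda>\<kappa>. hessian (\<Phi> i) (free_state G P v \<kappa>))" for i
    by (rule continuous_on_compose2[OF C2_continuous_hessian[OF C2_feature] continuous_on_free_state])
      auto
qed

lemma psd_resolvent:
  assumes \<kappa>: "\<kappa> \<in> K"
  shows "psd_resolvent P (free_hessian G P v \<kappa>) (resolvent G P v \<kappa>)"
proof
  show "transpose P ** P = mat 1" by (rule isometry)
  show "\<exists>!y. resolvent_solution (free_hessian G P v \<kappa>) P f y" for f
    using solvable[OF \<kappa>] by (simp add: has_resolvent_def)
  show "resolvent G P v \<kappa> = matrix (\<lambda>f. THE y. resolvent_solution (free_hessian G P v \<kappa>) P f y)"
    by (simp add: resolvent_def)
  show "u \<bullet> (free_hessian G P v \<kappa> *v z) = z \<bullet> (free_hessian G P v \<kappa> *v u)" for u z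
    unfolding free_hessian_def by (rule C2_hessian_inner_commute[OF C2_energy])
  \<comment> \<open>A line through the free state in a direction annihilated by
    \<open>transpose P\<close> stays on the input surface, so the free state minimizes the energy
    along it.\<close>
  show "0 \<le> y \<bullet> (free_hessian G P v \<kappa> *v y)" if y: "transpose P *v y = 0" for y
    unfolding free_hessian_def
  proof (rule C2_min_along_line[OF C2_energy])
    fix s
    have "free_state G P v \<kappa> + s *\<^sub>R y \<in> input_surface P v"
      using free_state_arg_min(1)[OF free[OF \<kappa>]] y
      by (simp add: input_surface_def matrix_vector_right_distrib matrix_vector_mult_scaleR)
    then show "G \<kappa> (free_state G P v \<kappa>) \<le> G \<kappa> (free_state G P v \<kappa> + s *\<^sub>R y)"
      by (rule free_state_arg_min(2)[OF free[OF \<kappa>]])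
  qed
qed

lemma continuous_on_resolvent: "continuous_on K (\<lambda>\<kappa>. resolvent G P v \<kappa> *v f)"
proof -
  let ?A = "\<lambda>\<kappa>. compressed_hessian P (free_hessian G P v \<kappa>)"
  let ?b = "f - P *v (transpose P *v f)"
  have entry: "continuous_on K (\<lambda>\<kappa>. ?A \<kappa> $ i $ j)" for i j
    by (intro continuous_intros continuous_on_compressed_hessian continuous_on_free_hessian)
  have "continuous_on K (\<lambda>\<kappa>. \<chi> k. det (\<chi> i j. if j = k then ?b $ i else ?A \<kappa> $ i $ j) / det (?A \<kappa>))"
  proof (intro continuous_on_vec_lambda continuous_on_divide continuous_on_det)
    show "continuous_on K (\<lambda>\<kappa>. (\<chi> i j. if j = k then ?b $ i else ?A \<kappa> $ i $ j) $ i $ j)" for i j k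
      using entry by (cases "j = k") auto
    show "\<forall>\<kappa>\<in>K. det (?A \<kappa>) \<noteq> 0"
      using unique_resolvent.det_nonzero psd_resolvent.axioms(1)[OF psd_resolvent] by blast
  qed (rule entry)
  then show ?thesis
    by (rule continuous_on_cong[THEN iffD1, rotated 2])
      (simp_all add: unique_resolvent.cramer_formula[OF psd_resolvent.axioms(1)[OF psd_resolvent]])
qed

end

section \<open>One-by-one output matrices\<close>

lemma output_response_diagonal:
  "output_response G P Q v \<kappa> $ k $ k = column k Q \<bullet> (resolvent G P v \<kappa> *v column k Q)"
proof -
  have "output_response G P Q v \<kappa> $ k $ k
      = axis k 1 \<bullet> (transpose Q *v (resolvent G P v \<kappa> *v (Q *v axis k 1)))"
    unfolding output_response_def matrix_entry_inner[of _ k k]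
    by (simp add: matrix_vector_mul_assoc matrix_mul_assoc)
  then show ?thesis by (simp add: transpose_matrix_inner[symmetric] matrix_vector_mult_basis)
qed

lemma learning_velocity_scaleR: "learning_velocity G x (c *\<^sub>R y) \<kappa> = c *\<^sub>R learning_velocity G x y \<kappa>"
  by (simp add: learning_velocity_def vec_eq_iff)

lemma matrix_inv_left_inverse: "invertible A \<Longrightarrow> matrix_inv A ** A = mat 1" for A :: "real^'n^'n"
  unfolding invertible_def matrix_inv_def by (rule someI2_ex) auto

lemma card_one_UNIV:
  assumes "CARD('o::finite) = 1"
  shows "UNIV = {k :: 'o}"
  using assms by (metis UNIV_I card_1_singletonE singletonD)

text \<open>Every index equals \<open>k\<close>, so matrix products reduce to products of the single
  entry. The last claim is what makes the clamped error a scalar multiple of the error.\<close>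

lemma single_output_matrix_inv:
  fixes M :: "real^'o^'o"
  assumes card: "CARD('o) = 1" and nz: "M $ k $ k \<noteq> 0"
  shows "matrix_inv M ** M = mat 1" and "matrix_inv M $ k $ k = 1 / M $ k $ k"
    and "matrix_inv M *v r = (matrix_inv M $ k $ k) *\<^sub>R r"
proof -
  have U: "(UNIV :: 'o set) = {k}" by (rule card_one_UNIV[OF card])
  then have eq: "i = k" for i by auto
  have "invertible M"
    unfolding invertible_left_inverse
    by (rule exI[of _ "\<chi> i j. 1 / M $ k $ k"])
      (use nz eq in \<open>simp add: matrix_matrix_mult_def U mat_def vec_eq_iff\<close>, metis)
  then show inv: "matrix_inv M ** M = mat 1" by (rule matrix_inv_left_inverse)
  have "(matrix_inv M ** M) $ k $ k = 1" unfolding inv by (simp add: mat_def)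
  then show "matrix_inv M $ k $ k = 1 / M $ k $ k"
    using nz by (simp add: matrix_matrix_mult_def U field_simps)
  show "matrix_inv M *v r = (matrix_inv M $ k $ k) *\<^sub>R r"
    by (simp add: vec_eq_iff matrix_vector_mult_def U) (metis eq)
qed

section \<open>Linear circuits\<close>

lemma laplacian_mult:
  "laplacian s t \<kappa> *v x =
    (\<Sum>e\<in>UNIV. (\<kappa> $ e * (incidence_vector s t e \<bullet> x)) *\<^sub>R incidence_vector s t e)"
  by (simp add: laplacian_def sum_matrix_vector_mult scaleR_matrix_vector_assoc[symmetric] outer_product_mult)

lemma laplacian_inner_commute: "x \<bullet> (laplacian s t \<kappa> *v y) = y \<bullet> (laplacian s t \<kappa> *v x)"
  by (simp add: laplacian_mult inner_sum_right inner_commute ac_simps)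

lemma linear_circuit_energy_separable:
  "linear_circuit_energy s t = separable_energy (\<lambda>e c. c) (\<lambda>e x. 1/2 * (incidence_vector s t e \<bullet> x)\<^sup>2)"
  by (simp add: fun_eq_iff linear_circuit_energy_def separable_energy_def laplacian_mult inner_sum_right
      sum_distrib_left inner_commute power2_eq_square ac_simps)

text \<open>All parameters are conductances, and the identity coefficient vanishes at 0, as removal
  of an edge demands.\<close>

lemma linear_circuit_regular:
  "regular_separable UNIV (\<lambda>e c. c) (\<lambda>e x. 1/2 * (incidence_vector s t e \<bullet> x)\<^sup>2)"
  unfolding regular_separable_def using half_square_derivatives(1) by (auto intro: continuous_intros)

lemma hessian_linear_circuit: "hessian (linear_circuit_energy s t \<kappa>) x = laplacian s t \<kappa>"
proof -
  have "linear_circuit_energy s t \<kappa> = (\<lambda>x. \<Sum>e\<in>UNIV. \<kappa> $ e * (1/2 * (incidence_vector s t e \<bullet> x)\<^sup>2))"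
    by (simp add: linear_circuit_energy_separable separable_energy_def fun_eq_iff)
  then show ?thesis
    using C2_sum(3)[of "\<lambda>e x. 1/2 * (incidence_vector s t e \<bullet> x)\<^sup>2" "\<lambda>e. \<kappa> $ e" UNIV,
        OF half_square_derivatives(1)]
    by (simp only: half_square_derivatives(2) laplacian_def)
qed

lemma linear_circuit_energy_add:
  "linear_circuit_energy s t \<kappa> (x + y) =
    linear_circuit_energy s t \<kappa> x + y \<bullet> (laplacian s t \<kappa> *v x) + linear_circuit_energy s t \<kappa> y"
  by (simp add: linear_circuit_energy_def matrix_vector_right_distrib inner_add_left inner_add_right
      laplacian_inner_commute[of x s t \<kappa> y])

context
  fixes P :: "real^'p^'n" and v :: "real^'p" and s t :: "'m::finite \<Rightarrow> 'n" and \<kappa> :: "real^'m"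
  assumes isometry: "transpose P ** P = mat 1"
    and convex: "strictly_convex_on (input_surface P v) (linear_circuit_energy s t \<kappa>)"
begin

text \<open>For a quadratic energy the midpoint inequality already gives definiteness: constant and
  linear terms cancel, leaving a quarter of the energy of \<open>y\<close> below half of it.\<close>

lemma laplacian_pos:
  assumes y: "transpose P *v y = 0" "y \<noteq> 0"
  shows "0 < y \<bullet> (laplacian s t \<kappa> *v y)"
proof -
  let ?f = "linear_circuit_energy s t \<kappa>"
  \<comment> \<open>An explicit base point of the input surface, since
    \<open>transpose P ** P\<close> is the identity.\<close>
  let ?x = "P *v v"
  let ?h = "(1/2) *\<^sub>R y"
  have S: "?x \<in> input_surface P v" "?x + y \<in> input_surface P v"
    using y by (simp_all add: input_surface_def matrix_vector_right_distrib transpose_input_mult[OF isometry])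
  have "\<forall>u. ?x \<noteq> ?x + y \<and> 0 < u \<and> u < 1 \<longrightarrow>
      ?f ((1 - u) *\<^sub>R ?x + u *\<^sub>R (?x + y)) < (1 - u) * ?f ?x + u * ?f (?x + y)"
    using convex S unfolding strictly_convex_on_def by blast
  from spec[OF this, of "1/2"] y(2)
  have "?f ((1/2) *\<^sub>R ?x + (1/2) *\<^sub>R (?x + y)) < ?f ?x / 2 + ?f (?x + y) / 2" by simp
  also have "(1/2) *\<^sub>R ?x + (1/2) *\<^sub>R (?x + y) = ?x + ?h"
    by (simp add: scaleR_right_distrib flip: scaleR_left_distrib)
  finally have "?f (?x + ?h) < ?f ?x / 2 + ?f (?x + y) / 2" .
  moreover have "?f (?x + ?h) = ?f ?x + (y \<bullet> (laplacian s t \<kappa> *v ?x)) / 2 + ?f y / 4"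
    unfolding linear_circuit_energy_add by (simp add: linear_circuit_energy_def matrix_vector_mult_scaleR)
  moreover have "?f (?x + y) = ?f ?x + y \<bullet> (laplacian s t \<kappa> *v ?x) + ?f y"
    by (rule linear_circuit_energy_add)
  ultimately have "0 < ?f y" by linarith
  then show ?thesis by (simp add: linear_circuit_energy_def)
qed

text \<open>Pairing a homogeneous solution \<open>y\<close> with its equation removes the multiplier
  term and leaves the Laplacian form at \<open>y\<close>, which is positive unless
  \<open>y = 0\<close>.\<close>

lemma linear_circuit_unique_solution: "\<exists>!y. resolvent_solution (laplacian s t \<kappa>) P f y"
proof -
  have "\<forall>y. compressed_hessian P (laplacian s t \<kappa>) *v y = 0 \<longrightarrow> y = 0"
  proof (intro allI impI)
    fix y assume "compressed_hessian P (laplacian s t \<kappa>) *v y = 0"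
    then have "resolvent_solution (laplacian s t \<kappa>) P 0 y"
      by (simp add: resolvent_solution_iff[OF isometry])
    then obtain \<mu> where \<mu>: "laplacian s t \<kappa> *v y + P *v \<mu> = 0" and y: "transpose P *v y = 0"
      by (auto simp: resolvent_solution_def)
    have "y \<bullet> (laplacian s t \<kappa> *v y) + y \<bullet> (P *v \<mu>) = 0"
      using \<mu> by (metis inner_add_right inner_zero_right)
    moreover have "y \<bullet> (P *v \<mu>) = 0" using y by (simp add: inner_commute[of y] transpose_matrix_inner)
    ultimately show "y = 0" using laplacian_pos[OF y] by auto
  qed
  then have "det (compressed_hessian P (laplacian s t \<kappa>)) \<noteq> 0"
    by (simp add: invertible_det_nz[symmetric] invertible_left_inverse matrix_left_invertible_ker)
  then show ?thesis using resolvent_solution_unique_iff_det[OF isometry] by blast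
qed

lemma linear_circuit_has_resolvent: "has_resolvent (linear_circuit_energy s t) P v \<kappa>"
  using linear_circuit_unique_solution by (simp add: has_resolvent_def free_hessian_def hessian_linear_circuit)

text \<open>A minimizer is constructed as a stationary point of the constrained problem. Expanding
  the energy around it leaves only a nonnegative quadratic term.\<close>

lemma linear_circuit_has_free_state: "has_free_state (linear_circuit_energy s t) P v \<kappa>"
proof -
  let ?L = "laplacian s t \<kappa>" and ?f = "linear_circuit_energy s t \<kappa>"
  obtain y where "resolvent_solution ?L P (- (?L *v (P *v v))) y"
    using linear_circuit_unique_solution by blast
  then obtain \<mu> where \<mu>: "?L *v y + P *v \<mu> = - (?L *v (P *v v))" and y: "transpose P *v y = 0"
    by (auto simp: resolvent_solution_def)
  \<comment> \<open>The correction \<open>y\<close> solves the constrained system with the residual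
    force of the base point, so the Laplacian maps \<open>x\<close> into the range of
    \<open>P\<close>.\<close>
  define x where "x = P *v v + y"
  have Lx: "?L *v x = - (P *v \<mu>)"
    using \<mu> by (simp add: x_def matrix_vector_right_distrib eq_neg_iff_add_eq_0 algebra_simps)
  have x: "x \<in> input_surface P v"
    using y by (simp add: x_def input_surface_def matrix_vector_right_distrib transpose_input_mult[OF isometry])
  have "?f x \<le> ?f z" if z: "z \<in> input_surface P v" for z
  proof -
    have d: "transpose P *v (z - x) = 0"
      using x z by (simp add: input_surface_def matrix_vector_mult_diff_distrib)
    have "(z - x) \<bullet> (?L *v x) = 0"
      using d by (simp add: Lx inner_commute[of "z - x"] transpose_matrix_inner)
    moreover have "0 \<le> ?f (z - x)"
      using laplacian_pos[OF d] by (cases "z - x = 0") (auto simp: linear_circuit_energy_def)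
    ultimately show ?thesis using linear_circuit_energy_add[of s t \<kappa> x "z - x"] by simp
  qed
  with x show ?thesis by (auto simp: has_free_state_def is_arg_min_linorder)
qed

end

section \<open>A single output\<close>

context separable_network
begin

context
  fixes Q :: "real^'o^'n" and w :: "real^'o" and k :: 'o
  assumes single: "CARD('o) = 1" and column: "column k Q \<notin> range ((*v) P)"
begin

lemma output_response_pos: "\<kappa> \<in> K \<Longrightarrow> 0 < output_response G P Q v \<kappa> $ k $ k"
  unfolding output_response_diagonal by (rule psd_resolvent.resolvent_pos[OF psd_resolvent column])

lemma clamp_matrix_single:
  assumes "\<kappa> \<in> K"
  shows "clamp_matrix G P Q v \<kappa> ** output_response G P Q v \<kappa> = mat 1"
    and "clamp_matrix G P Q v \<kappa> $ k $ k = 1 / output_response G P Q v \<kappa> $ k $ k"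
    and "clamp_matrix G P Q v \<kappa> *v r = (clamp_matrix G P Q v \<kappa> $ k $ k) *\<^sub>R r"
  using single_output_matrix_inv[OF single less_imp_neq[OF output_response_pos[OF assms], symmetric]]
  by (simp_all add: clamp_matrix_def)

lemma clamp_matrix_pos: "\<kappa> \<in> K \<Longrightarrow> 0 < clamp_matrix G P Q v \<kappa> $ k $ k"
  by (simp add: clamp_matrix_single output_response_pos)

lemma continuous_on_clamp_matrix: "continuous_on K (\<lambda>\<kappa>. clamp_matrix G P Q v \<kappa> $ k $ k)"
proof -
  have "continuous_on K (\<lambda>\<kappa>. 1 / output_response G P Q v \<kappa> $ k $ k)"
    unfolding output_response_diagonal
    by (intro continuous_intros continuous_on_resolvent)
      (use output_response_pos in \<open>force simp: output_response_diagonal\<close>)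
  then show ?thesis by (simp add: clamp_matrix_single cong: continuous_on_cong)
qed

lemma CL_velocity_single:
  assumes "\<kappa> \<in> K"
  shows "CL_velocity G P Q v w \<kappa> = (clamp_matrix G P Q v \<kappa> $ k $ k) *\<^sub>R EP_velocity G P Q v w \<kappa>"
  unfolding CL_velocity_def EP_velocity_def clamp_matrix_single(3)[OF assms]
  by (simp add: matrix_vector_mult_scaleR learning_velocity_scaleR)

lemma EP_velocity_single:
  assumes "\<kappa> \<in> K"
  shows "EP_velocity G P Q v w \<kappa> = (1 / clamp_matrix G P Q v \<kappa> $ k $ k) *\<^sub>R CL_velocity G P Q v w \<kappa>"
  using clamp_matrix_pos[OF assms] by (simp add: CL_velocity_single[OF assms])

lemma inverse_clamp_matrix_rescaling:
  "\<kappa> \<in> K \<Longrightarrow> 0 < 1 / clamp_matrix G P Q v \<kappa> $ k $ k"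
  "continuous_on K (\<lambda>\<kappa>. 1 / clamp_matrix G P Q v \<kappa> $ k $ k)"
  using clamp_matrix_pos by (auto intro!: continuous_intros continuous_on_clamp_matrix) force

text \<open>Each bundle lists positivity, continuity and proportionality in the order of the
  assumptions of the rescaling context; the second bundle uses the reciprocal factor and reverses
  the direction.\<close>

lemmas EP_to_CL = clamp_matrix_pos continuous_on_clamp_matrix CL_velocity_single
lemmas CL_to_EP = inverse_clamp_matrix_rescaling EP_velocity_single

lemma CL_of_EP_trajectory:
  assumes "maximal_trajectory C K (EP_velocity G P Q v w) \<gamma> T"
  shows "\<exists>\<gamma>' T'. maximal_trajectory C K (CL_velocity G P Q v w) \<gamma>' T'
    \<and> time_changed (\<lambda>\<kappa>. clamp_matrix G P Q v \<kappa> $ k $ k) \<gamma> T \<gamma>' T'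
    \<and> omega_limit_set \<gamma>' T' = omega_limit_set \<gamma> T"
  using maximal_trajectory_rescaled[OF EP_to_CL assms] by metis

text \<open>Rescaling by the reciprocal gives a time change from CL to EP; inverting it produces the
  factor \<open>1 / (1 / D)\<close>, hence the same factor as in the other direction.\<close>

lemma EP_of_CL_trajectory:
  assumes max: "maximal_trajectory C K (CL_velocity G P Q v w) \<gamma>' T'"
  shows "\<exists>\<gamma> T. maximal_trajectory C K (EP_velocity G P Q v w) \<gamma> T
    \<and> time_changed (\<lambda>\<kappa>. clamp_matrix G P Q v \<kappa> $ k $ k) \<gamma> T \<gamma>' T'
    \<and> omega_limit_set \<gamma>' T' = omega_limit_set \<gamma> T"
proof -
  obtain \<gamma> T where *: "maximal_trajectory C K (EP_velocity G P Q v w) \<gamma> T"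
    "time_changed (\<lambda>\<kappa>. 1 / clamp_matrix G P Q v \<kappa> $ k $ k) \<gamma>' T' \<gamma> T"
    "omega_limit_set \<gamma> T = omega_limit_set \<gamma>' T'"
    using maximal_trajectory_rescaled[OF CL_to_EP max] by metis
  have "time_changed (\<lambda>\<kappa>. 1 / (1 / clamp_matrix G P Q v \<kappa> $ k $ k)) \<gamma> T \<gamma>' T'"
    by (rule time_changed_sym[OF *(2)], rule inverse_clamp_matrix_rescaling)
      (use max in \<open>simp add: maximal_trajectory_def trajectory_def\<close>)
  with * show ?thesis by auto
qed

lemma orbits_eq: "orbits C K (EP_velocity G P Q v w) \<kappa>\<^sub>0 = orbits C K (CL_velocity G P Q v w) \<kappa>\<^sub>0"
  by (intro equalityI orbits_rescaled[OF EP_to_CL] orbits_rescaled[OF CL_to_EP])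

lemma omega_limit_sets_eq:
  "omega_limit_sets C K (EP_velocity G P Q v w) \<kappa>\<^sub>0 = omega_limit_sets C K (CL_velocity G P Q v w) \<kappa>\<^sub>0"
  by (intro equalityI omega_limit_sets_rescaled[OF EP_to_CL] omega_limit_sets_rescaled[OF CL_to_EP])

lemma no_selection_difference: "\<not> selection_difference C K G P Q v w"
  unfolding selection_difference_def
  using selected_rescaled[OF EP_to_CL] selected_rescaled[OF CL_to_EP] by blast

end

end

theorem mainTheorem1:
  fixes G :: "real^'m \<Rightarrow> real^'n \<Rightarrow> real"
    and C :: "'m set" and K :: "(real^'m) set"
    and inp :: "'p::finite \<Rightarrow> 'n" and ground :: 'n
    and P :: "real^'p^'n" and Q :: "real^'o^'n"
    and v :: "real^'p" and w :: "real^'o"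
    and R :: "real^'m \<Rightarrow> real^'n^'n" and D :: "real^'m \<Rightarrow> real^'o^'o"
    and F_EP F_CL :: "real^'m \<Rightarrow> real^'m"
  defines "P \<equiv> input_matrix inp"
    and "R \<equiv> resolvent G P v"
    and "D \<equiv> clamp_matrix G P Q v"
    and "F_EP \<equiv> EP_velocity G P Q v w"
    and "F_CL \<equiv> CL_velocity G P Q v w"
  assumes inputs: "inj inp" "ground \<in> range inp"
    and outputs: "output_matrix (range inp) Q"
    and nonneg: "\<And>\<kappa> i. \<kappa> \<in> K \<Longrightarrow> i \<in> C \<Longrightarrow> 0 \<le> \<kappa> $ i"
    and convex: "\<And>\<kappa>. \<kappa> \<in> K \<Longrightarrow> strictly_convex_on (input_surface P v) (G \<kappa>)"
    and energy:
      "(\<exists>s t. connected_circuit s t \<and> G = linear_circuit_energy s t \<and> C = UNIV) \<or>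
       (\<exists>g \<Phi>. regular_separable C g \<Phi> \<and> G = separable_energy g \<Phi> \<and>
          (\<forall>\<kappa>\<in>K. has_free_state G P v \<kappa> \<and> has_resolvent G P v \<kappa>))"
  shows "(CARD('o) = 1 \<longrightarrow>
      (\<forall>\<kappa>\<in>K. has_free_state G P v \<kappa> \<and> has_resolvent G P v \<kappa>
         \<and> transpose (R \<kappa>) = R \<kappa> \<and> (\<forall>f. 0 \<le> f \<bullet> (R \<kappa> *v f))
         \<and> {f. R \<kappa> *v f = 0} = range ((*v) P))
    \<and> (\<forall>k. column k Q \<notin> range ((*v) P))
    \<and> (\<forall>k. \<forall>\<kappa>\<in>K. 0 < output_response G P Q v \<kappa> $ k $ k
         \<and> D \<kappa> ** output_response G P Q v \<kappa> = mat 1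
         \<and> D \<kappa> $ k $ k = 1 / (output_response G P Q v \<kappa> $ k $ k) \<and> 0 < D \<kappa> $ k $ k
         \<and> F_CL \<kappa> = (D \<kappa> $ k $ k) *\<^sub>R F_EP \<kappa>)
    \<and> (\<forall>k. continuous_on K (\<lambda>\<kappa>. D \<kappa> $ k $ k))
    \<and> (\<forall>k \<gamma> T. maximal_trajectory C K F_EP \<gamma> T \<longrightarrow>
         (\<exists>\<gamma>' T'. maximal_trajectory C K F_CL \<gamma>' T' \<and> time_changed (\<lambda>\<kappa>. D \<kappa> $ k $ k) \<gamma> T \<gamma>' T'
            \<and> omega_limit_set \<gamma>' T' = omega_limit_set \<gamma> T))
    \<and> (\<forall>k \<gamma>' T'. maximal_trajectory C K F_CL \<gamma>' T' \<longrightarrow>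
         (\<exists>\<gamma> T. maximal_trajectory C K F_EP \<gamma> T \<and> time_changed (\<lambda>\<kappa>. D \<kappa> $ k $ k) \<gamma> T \<gamma>' T'
            \<and> omega_limit_set \<gamma>' T' = omega_limit_set \<gamma> T))
    \<and> (\<forall>\<kappa>\<^sub>0. orbits C K F_EP \<kappa>\<^sub>0 = orbits C K F_CL \<kappa>\<^sub>0
         \<and> omega_limit_sets C K F_EP \<kappa>\<^sub>0 = omega_limit_sets C K F_CL \<kappa>\<^sub>0))
    \<and> (selection_difference C K G P Q v w \<longrightarrow> 2 \<le> CARD('o))"
proof -
  have isometry: "transpose P ** P = mat 1"
    unfolding P_def by (rule input_matrix_isometry[OF inputs(1)])
  have column: "column k Q \<notin> range ((*v) P)" for k
    unfolding P_def by (rule output_column_not_input[OF outputs])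
  \<comment> \<open>Both kinds of energy are brought to the same separable form here. Existence of
    free state and resolvent is proved in the linear case and taken from the hypothesis
    otherwise.\<close>
  obtain g \<Phi> where regular: "regular_separable C g \<Phi>" "G = separable_energy g \<Phi>"
    and exist: "\<And>\<kappa>. \<kappa> \<in> K \<Longrightarrow> has_free_state G P v \<kappa> \<and> has_resolvent G P v \<kappa>"
    using energy
  proof (elim disjE exE conjE)
    fix s t assume G: "G = linear_circuit_energy s t" and C: "C = UNIV"
    show thesis
    proof (rule that)
      show "regular_separable C (\<lambda>e c. c) (\<lambda>e x. 1/2 * (incidence_vector s t e \<bullet> x)\<^sup>2)"
        unfolding C by (rule linear_circuit_regular)
      show "G = separable_energy (\<lambda>e c. c) (\<lambda>e x. 1/2 * (incidence_vector s t e \<bullet> x)\<^sup>2)"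
        unfolding G by (rule linear_circuit_energy_separable)
      fix \<kappa> assume "\<kappa> \<in> K"
      then show "has_free_state G P v \<kappa> \<and> has_resolvent G P v \<kappa>"
        using convex unfolding G
        by (intro conjI linear_circuit_has_free_state[OF isometry] linear_circuit_has_resolvent[OF isometry])
    qed
  qed (use that in blast)
  interpret separable_network C K g \<Phi> P v G
    by unfold_locales (use isometry regular nonneg convex exist in auto)
  show ?thesis
  proof (intro conjI impI)
    assume single: "CARD('o) = 1"
    show "\<forall>\<kappa>\<in>K. has_free_state G P v \<kappa> \<and> has_resolvent G P v \<kappa>
         \<and> transpose (R \<kappa>) = R \<kappa> \<and> (\<forall>f. 0 \<le> f \<bullet> (R \<kappa> *v f))
         \<and> {f. R \<kappa> *v f = 0} = range ((*v) P)"
      unfolding R_def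
      by (intro ballI conjI allI free solvable psd_resolvent.transpose_resolvent[OF psd_resolvent]
          psd_resolvent.resolvent_psd[OF psd_resolvent]
          unique_resolvent.kernel[OF psd_resolvent.axioms(1)[OF psd_resolvent]])
    show "\<forall>k. column k Q \<notin> range ((*v) P)" using column by blast
    show "\<forall>k. \<forall>\<kappa>\<in>K. 0 < output_response G P Q v \<kappa> $ k $ k
         \<and> D \<kappa> ** output_response G P Q v \<kappa> = mat 1
         \<and> D \<kappa> $ k $ k = 1 / (output_response G P Q v \<kappa> $ k $ k) \<and> 0 < D \<kappa> $ k $ k
         \<and> F_CL \<kappa> = (D \<kappa> $ k $ k) *\<^sub>R F_EP \<kappa>"
      unfolding D_def F_EP_def F_CL_def
      by (intro allI ballI conjI output_response_pos clamp_matrix_single(1,2) clamp_matrix_pos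
          CL_velocity_single single column)
    show "\<forall>k. continuous_on K (\<lambda>\<kappa>. D \<kappa> $ k $ k)"
      unfolding D_def by (intro allI continuous_on_clamp_matrix single column)
    show "\<forall>k \<gamma> T. maximal_trajectory C K F_EP \<gamma> T \<longrightarrow>
         (\<exists>\<gamma>' T'. maximal_trajectory C K F_CL \<gamma>' T' \<and> time_changed (\<lambda>\<kappa>. D \<kappa> $ k $ k) \<gamma> T \<gamma>' T'
            \<and> omega_limit_set \<gamma>' T' = omega_limit_set \<gamma> T)"
      unfolding D_def F_EP_def F_CL_def by (intro allI impI CL_of_EP_trajectory single column)
    show "\<forall>k \<gamma>' T'. maximal_trajectory C K F_CL \<gamma>' T' \<longrightarrow>
         (\<exists>\<gamma> T. maximal_trajectory C K F_EP \<gamma> T \<and> time_changed (\<lambda>\<kappa>. D \<kappa> $ k $ k) \<gamma> T \<gamma>' T'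
            \<and> omega_limit_set \<gamma>' T' = omega_limit_set \<gamma> T)"
      unfolding D_def F_EP_def F_CL_def by (intro allI impI EP_of_CL_trajectory single column)
    show "\<forall>\<kappa>\<^sub>0. orbits C K F_EP \<kappa>\<^sub>0 = orbits C K F_CL \<kappa>\<^sub>0
         \<and> omega_limit_sets C K F_EP \<kappa>\<^sub>0 = omega_limit_sets C K F_CL \<kappa>\<^sub>0"
      unfolding F_EP_def F_CL_def
      by (intro allI conjI orbits_eq[OF single column] omega_limit_sets_eq[OF single column])
  next
    \<comment> \<open>The type \<open>'o\<close> is nonempty, so excluding cardinality 1 leaves at
      least 2.\<close>
    assume "selection_difference C K G P Q v w"
    then have "CARD('o) \<noteq> 1" using no_selection_difference[OF _ column] by blast
    moreover have "0 < CARD('o)" by simp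
    ultimately show "2 \<le> CARD('o)" by linarith
  qed
qed

end
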